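(* Let $S\in\mathcal M_d(\mathbb C)^+$ and let $\mathbf a=(a_i)_{i=1}^k$ be positive real numbers. For a strictly convex unitarily invariant norm $N$ on $\mathcal M_d(\mathbb C)$, let $\Psi_N:\mathcal X_{\mathbf a}\to\mathbb R_{\ge0}$ be given by $\Psi_N(S_{\mathcal G})=N(S-S_{\mathcal G})$. Then every local minimizer $S_{\mathcal G_0}\in\mathcal X_{\mathbf a}$ of $\Psi_N$ is a global minimizer of $\Psi_N$, and the set of these minimizers does not depend on the choice of the strictly convex unitarily invariant norm $N$.
   Context: $\mathcal M_d(\mathbb C)^+$ is the set of positive semidefinite $d\times d$ complex matrices. For $\mathcal G=\{g_i\}_{i=1}^k\in(\mathbb C^d)^k$, $S_{\mathcal G}=\sum_{i=1}^kg_ig_i^*$. $\mathcal X_{\mathbf a}=\{S_{\mathcal G}:\mathcal G=\{g_i\}_{i=1}^k\in(\mathbb C^d)^k,\ \|g_i\|^2=a_i\text{ for }1\le i\le k\}\subset\mathcal M_d(\mathbb C)^+$, with the topology inherited from $\mathcal M_d(\mathbb C)$. A norm $N$ on $\mathcal M_d(\mathbb C)$ is unitarily invariant if $N(UAV)=N(A)$ for all $A$ and unitary $U,V$; it is strictly convex if its restriction to diagonal matrices is a strictly convex norm on $\mathbb C^d$. *)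

theory Defs
  imports "HOL-Analysis.Analysis"
begin

definition conj_transpose :: "complex ^ 'n ^ 'm \<Rightarrow> complex ^ 'm ^ 'n" where
  "conj_transpose A = (\<chi> i j. cnj (A $ j $ i))"

definition unitary_matrix :: "complex ^ 'd ^ 'd \<Rightarrow> bool" where
  "unitary_matrix U \<longleftrightarrow> conj_transpose U ** U = mat 1 \<and> U ** conj_transpose U = mat 1"

definition psd_matrix :: "complex ^ 'd ^ 'd \<Rightarrow> bool" where
  "psd_matrix A \<longleftrightarrow> conj_transpose A = A \<and>
     (\<forall>x :: complex ^ 'd. 0 \<le> Re (\<Sum>i\<in>UNIV. cnj (x $ i) * (A *v x) $ i))"

definition diag_matrix :: "complex ^ 'd \<Rightarrow> complex ^ 'd ^ 'd" where
  "diag_matrix x = (\<chi> i j. if i = j then x $ i else 0)"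

definition rank_one :: "complex ^ 'd \<Rightarrow> complex ^ 'd ^ 'd" where
  "rank_one g = (\<chi> i j. g $ i * cnj (g $ j))"

definition frame_operator :: "nat \<Rightarrow> (nat \<Rightarrow> complex ^ 'd) \<Rightarrow> complex ^ 'd ^ 'd" where
  "frame_operator k g = (\<Sum>i = 1..k. rank_one (g i))"

definition frame_operators :: "nat \<Rightarrow> (nat \<Rightarrow> real) \<Rightarrow> (complex ^ 'd ^ 'd) set" where
  "frame_operators k a =
     {frame_operator k g | g :: nat \<Rightarrow> complex ^ 'd. \<forall>i\<in>{1..k}. (norm (g i))\<^sup>2 = a i}"

text \<open>Homogeneity is over the complex scalars, which act entrywise.\<close>

definition matrix_norm :: "(complex ^ 'd ^ 'd \<Rightarrow> real) \<Rightarrow> bool" where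
  "matrix_norm N \<longleftrightarrow>
     (\<forall>A. 0 \<le> N A) \<and>
     (\<forall>A. N A = 0 \<longleftrightarrow> A = 0) \<and>
     (\<forall>c A. N (\<chi> i j. c * A $ i $ j) = cmod c * N A) \<and>
     (\<forall>A B. N (A + B) \<le> N A + N B)"

definition unitarily_invariant :: "(complex ^ 'd ^ 'd \<Rightarrow> real) \<Rightarrow> bool" where
  "unitarily_invariant N \<longleftrightarrow>
     (\<forall>A U V. unitary_matrix U \<longrightarrow> unitary_matrix V \<longrightarrow> N (U ** A ** V) = N A)"

text \<open>Strict convexity of a norm: its unit sphere contains no nondegenerate segment.\<close>

definition strictly_convex_norm :: "('a :: real_vector \<Rightarrow> real) \<Rightarrow> bool" where
  "strictly_convex_norm \<nu> \<longleftrightarrow>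
     (\<forall>x y t. \<nu> x = 1 \<longrightarrow> \<nu> y = 1 \<longrightarrow> x \<noteq> y \<longrightarrow> 0 < t \<longrightarrow> t < 1 \<longrightarrow>
        \<nu> ((1 - t) *\<^sub>R x + t *\<^sub>R y) < 1)"

definition strictly_convex_ui_norm :: "(complex ^ 'd ^ 'd \<Rightarrow> real) \<Rightarrow> bool" where
  "strictly_convex_ui_norm N \<longleftrightarrow>
     matrix_norm N \<and> unitarily_invariant N \<and> strictly_convex_norm (\<lambda>x. N (diag_matrix x))"

definition local_minimizer :: "('a :: topological_space \<Rightarrow> real) \<Rightarrow> 'a set \<Rightarrow> 'a \<Rightarrow> bool" where
  "local_minimizer f X x \<longleftrightarrow>
     x \<in> X \<and> (\<exists>W. open W \<and> x \<in> W \<and> (\<forall>y\<in>X \<inter> W. f x \<le> f y))"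

definition Psi :: "(complex ^ 'd ^ 'd \<Rightarrow> real) \<Rightarrow> complex ^ 'd ^ 'd \<Rightarrow> complex ^ 'd ^ 'd \<Rightarrow> real" where
  "Psi N S T = N (S - T)"

end

theory Submission
  imports Defs
begin

text \<open>
Write \<open>R = S - T\<close> for a frame operator \<open>T\<close> with the prescribed norms.  Apart from convexity and
continuity, the proof uses two facts about a strictly convex unitarily invariant norm: its value on a
Hermitian matrix depends only on the spectrum, and it strictly decreases when two different
eigenvalues are moved towards each other (\<open>ui_norm_average_less\<close>).  Both are common to all these norms, so whatever they force on a
local minimizer is independent of the norm.  The proof derives conditions of this kind that pin
down the spectrum of \<open>R\<close> completely.  Since the set of frame operators is compact, each norm also has
a global minimizer; being local, it has that same spectrum, so every local minimizer of one norm is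
a global minimizer of every other one (\<open>local_minimizer_imp_global\<close>).

The conditions are found in three steps.

\<^item> If some frame vector \<open>g\<close> of a local minimizer had components in two eigenspaces of \<open>R\<close>, a rotation
  of \<open>g\<close> on its sphere would, to first order, bring these two eigenvalues closer together; the rest of
  the first-order change is tangent to the unitary orbit of \<open>R\<close> and does not change the norm to first
  order.  Hence all frame vectors are eigenvectors of \<open>R\<close> (\<open>frame_vector_eigenvector\<close>), and \<open>S\<close> and \<open>T\<close>
  commute.

\<^item> Take a common eigenbasis with eigenvalues \<open>\<sigma>\<close> of \<open>S\<close> in decreasing order and corresponding
  eigenvalues \<open>x\<close> of \<open>T\<close>.  If \<open>\<sigma> i > \<sigma> j\<close> and \<open>x i < x j\<close>, a small rotation of \<open>T\<close> in the plane of the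
  two eigenvectors brings two eigenvalues of \<open>R\<close> closer together.  So \<open>x\<close> is decreasing as well
  (\<open>local_minimizer_aligned\<close>).

\<^item> By the Schur-Horn theorem the decreasing spectra of frame operators are the \<open>x \<ge> 0\<close> with the right
  total whose prefix sums dominate those of \<open>a\<close> sorted decreasingly (\<open>feasible\<close>).  Moving a small amount
  from \<open>x j\<close> to \<open>x i\<close> inside this polytope brings \<open>\<sigma> i - x i\<close> and \<open>\<sigma> j - x j\<close> together if the former is the
  larger one, so at a local minimizer no such exchange exists (\<open>exchange_optimal\<close>).

Finally two exchange-optimal points \<open>x\<close> and \<open>y\<close> of the polytope coincide
(\<open>exchange_optimal_unique\<close>).  At the first index \<open>i\<close> where they differ let \<open>x i < y i\<close>, and let \<open>j\<close> be
the next index with \<open>x j > y j\<close>.  Then \<open>x\<close> admits the exchange from \<open>j\<close> to \<open>i\<close> and \<open>y\<close> the opposite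
one, and the two resulting inequalities contradict each other.
\<close>

section \<open>The Hermitian inner product and rank-one matrices\<close>

definition cinner :: "complex ^ 'd \<Rightarrow> complex ^ 'd \<Rightarrow> complex" where
  "cinner x y = (\<Sum>i\<in>UNIV. cnj (x $ i) * y $ i)"

definition sym_outer :: "complex ^ 'd \<Rightarrow> complex ^ 'd \<Rightarrow> complex ^ 'd ^ 'd" where
  "sym_outer x y = (\<chi> i j. x $ i * cnj (y $ j) + y $ i * cnj (x $ j))"

lemma cinner_add_left: "cinner (x + y) z = cinner x z + cinner y z"
  by (simp add: cinner_def distrib_right sum.distrib)

lemma cinner_add_right: "cinner x (y + z) = cinner x y + cinner x z"
  by (simp add: cinner_def distrib_left sum.distrib)

lemma cinner_diff_right: "cinner x (y - z) = cinner x y - cinner x z"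
  by (simp add: cinner_def right_diff_distrib sum_subtractf)

lemma cinner_diff_left: "cinner (x - y) z = cinner x z - cinner y z"
  by (simp add: cinner_def left_diff_distrib sum_subtractf)

lemma cinner_scale_right: "cinner x (c *s y) = c * cinner x y"
  by (simp add: cinner_def sum_distrib_left mult_ac)

lemma cinner_scale_left: "cinner (c *s x) y = cnj c * cinner x y"
  by (simp add: cinner_def sum_distrib_left mult_ac)

lemma scaleR_vec_eq: "r *\<^sub>R (y :: complex ^ 'd) = of_real r *s y"
  by (simp add: vec_eq_iff) (simp add: scaleR_conv_of_real)

lemma cinner_scaleR_right: "cinner x (r *\<^sub>R y) = of_real r * cinner x y"
  by (simp add: scaleR_vec_eq cinner_scale_right)

lemma cinner_scaleR_left: "cinner (r *\<^sub>R x) y = of_real r * cinner x y"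
  by (simp add: scaleR_vec_eq cinner_scale_left)

lemma cinner_0 [simp]: "cinner x 0 = 0" "cinner 0 x = 0"
  by (simp_all add: cinner_def)

lemma cinner_sum_right: "cinner x (\<Sum>i\<in>I. f i) = (\<Sum>i\<in>I. cinner x (f i))"
  by (induction I rule: infinite_finite_induct) (simp_all add: cinner_add_right)

lemma cinner_sum_left: "cinner (\<Sum>i\<in>I. f i) x = (\<Sum>i\<in>I. cinner (f i) x)"
  by (induction I rule: infinite_finite_induct) (simp_all add: cinner_add_left)

lemmas cinner_simps = cinner_add_left cinner_add_right cinner_diff_left cinner_diff_right
  cinner_scale_left cinner_scale_right cinner_scaleR_left cinner_scaleR_right

lemma cinner_commute: "cinner y x = cnj (cinner x y)"
  by (simp add: cinner_def mult.commute)

lemma Re_cinner: "Re (cinner x y) = x \<bullet> y"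
  by (simp add: cinner_def inner_vec_def inner_complex_def)

lemma cinner_self: "cinner x x = of_real ((norm x)\<^sup>2)"
  by (simp add: complex_eq_iff Re_cinner power2_norm_eq_inner)
     (simp add: cinner_def)

lemma cinner_self_eq_0 [simp]: "cinner x x = 0 \<longleftrightarrow> x = 0"
  by (simp add: cinner_self)

lemma cinner_conj_transpose: "cinner (conj_transpose A *v x) y = cinner x (A *v y)"
proof -
  have "cinner (conj_transpose A *v x) y = (\<Sum>i\<in>UNIV. \<Sum>j\<in>UNIV. A $ j $ i * cnj (x $ j) * y $ i)"
    by (simp add: cinner_def conj_transpose_def matrix_vector_mult_def sum_distrib_right)
  also have "\<dots> = (\<Sum>j\<in>UNIV. \<Sum>i\<in>UNIV. A $ j $ i * cnj (x $ j) * y $ i)"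
    by (rule sum.swap)
  also have "\<dots> = cinner x (A *v y)"
    by (simp add: cinner_def matrix_vector_mult_def sum_distrib_left mult_ac)
  finally show ?thesis .
qed

lemma cinner_hermitian: "conj_transpose A = A \<Longrightarrow> cinner (A *v x) y = cinner x (A *v y)"
  using cinner_conj_transpose[of A x y] by simp

lemma inner_hermitian: "conj_transpose A = A \<Longrightarrow> (A *v x) \<bullet> y = x \<bullet> (A *v y)"
  using cinner_hermitian[of A x y] by (metis Re_cinner)

lemma matrix_vector_mult_scaleR:
  "A *v (r *\<^sub>R x) = r *\<^sub>R (A *v (x :: complex ^ 'd))"
  by (simp add: vec_eq_iff matrix_vector_mult_def scaleR_sum_right)

lemma scaleR_matrix_vector_mult:
  "(r *\<^sub>R A) *v x = r *\<^sub>R (A *v (x :: complex ^ 'd))"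
  by (simp add: vec_eq_iff matrix_vector_mult_def scaleR_sum_right)

lemma sum_matrix_vector_mult: "(\<Sum>i\<in>I. F i) *v x = (\<Sum>i\<in>I. F i *v (x :: complex ^ 'd))"
  by (induction I rule: infinite_finite_induct)
     (simp_all add: matrix_vector_mult_add_rdistrib)

lemma matrix_vector_mult_sum: "A *v (\<Sum>i\<in>I. f i) = (\<Sum>i\<in>I. A *v (f i :: complex ^ 'd))"
  by (induction I rule: infinite_finite_induct) (simp_all add: matrix_vector_right_distrib)

lemma rank_one_mult: "rank_one g *v x = cinner g x *s g"
  by (simp add: vec_eq_iff rank_one_def matrix_vector_mult_def cinner_def sum_distrib_left sum_distrib_right mult_ac)

lemma conj_transpose_conj_transpose [simp]: "conj_transpose (conj_transpose A) = A"
  by (simp add: vec_eq_iff conj_transpose_def)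

lemma conj_transpose_mult: "conj_transpose (A ** B) = conj_transpose B ** conj_transpose A"
  by (simp add: vec_eq_iff conj_transpose_def matrix_matrix_mult_def mult_ac)

lemma conj_transpose_add: "conj_transpose (A + B) = conj_transpose A + conj_transpose B"
  by (simp add: vec_eq_iff conj_transpose_def)

lemma conj_transpose_diff: "conj_transpose (A - B) = conj_transpose A - conj_transpose B"
  by (simp add: vec_eq_iff conj_transpose_def)

lemma conj_transpose_scaleR: "conj_transpose (r *\<^sub>R A) = r *\<^sub>R conj_transpose A"
  by (simp add: vec_eq_iff conj_transpose_def)

lemma conj_transpose_sum: "conj_transpose (\<Sum>i\<in>I. F i) = (\<Sum>i\<in>I. conj_transpose (F i))"
  by (induction I rule: infinite_finite_induct)
     (simp_all add: conj_transpose_add, simp_all add: vec_eq_iff conj_transpose_def)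

lemma conj_transpose_rank_one [simp]: "conj_transpose (rank_one g) = rank_one g"
  by (simp add: vec_eq_iff conj_transpose_def rank_one_def mult.commute)

lemma hermitian_frame_operator: "conj_transpose (frame_operator k g) = frame_operator k g"
  by (simp add: frame_operator_def conj_transpose_sum)

lemma rank_one_scaleR: "rank_one (r *\<^sub>R g) = r\<^sup>2 *\<^sub>R rank_one g"
  by (simp add: vec_eq_iff rank_one_def power2_eq_square)

lemma rank_one_image: "rank_one (W *v g) = W ** rank_one g ** conj_transpose W"
proof -
  have "(W ** rank_one g ** conj_transpose W) $ i $ j = rank_one (W *v g) $ i $ j" for i j
    by (simp add: rank_one_def matrix_matrix_mult_def conj_transpose_def matrix_vector_mult_def
        sum_distrib_left sum_distrib_right mult_ac)
  then show ?thesis by (simp add: vec_eq_iff)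
qed

lemma rank_one_comb:
  "rank_one (p *\<^sub>R x + q *\<^sub>R y) =
     p\<^sup>2 *\<^sub>R rank_one x + q\<^sup>2 *\<^sub>R rank_one y + (p * q) *\<^sub>R sym_outer x y"
  by (simp add: vec_eq_iff rank_one_def sym_outer_def power2_eq_square algebra_simps)

lemma sym_outer_self: "sym_outer x x = 2 *\<^sub>R rank_one x"
  by (simp add: vec_eq_iff rank_one_def sym_outer_def scaleR_conv_of_real)

lemma sym_outer_add: "sym_outer (x + y) z = sym_outer x z + sym_outer y z"
  by (simp add: vec_eq_iff sym_outer_def algebra_simps)

lemma sym_outer_diff_right: "sym_outer x (y - z) = sym_outer x y - sym_outer x z"
  by (simp add: vec_eq_iff sym_outer_def algebra_simps)

lemma sym_outer_scaleR: "sym_outer (r *\<^sub>R x) y = r *\<^sub>R sym_outer x y"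
  by (simp add: vec_eq_iff sym_outer_def algebra_simps)

lemma sym_outer_scaleR_right: "sym_outer x (r *\<^sub>R y) = r *\<^sub>R sym_outer x y"
  by (simp add: vec_eq_iff sym_outer_def algebra_simps)

lemma sym_outer_0 [simp]: "sym_outer 0 y = 0" "sym_outer x 0 = 0"
  by (simp_all add: vec_eq_iff sym_outer_def)

lemma sym_outer_sum: "sym_outer (\<Sum>i\<in>I. f i) z = (\<Sum>i\<in>I. sym_outer (f i) z)"
  by (induction I rule: infinite_finite_induct) (simp_all add: sym_outer_add)

section \<open>Orthonormal bases and matrices with a given spectrum\<close>

definition orthonormal :: "nat \<Rightarrow> (nat \<Rightarrow> complex ^ 'd) \<Rightarrow> bool" where
  "orthonormal n u \<longleftrightarrow> (\<forall>i<n. \<forall>j<n. cinner (u i) (u j) = (if i = j then 1 else 0))"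

abbreviation onb :: "(nat \<Rightarrow> complex ^ 'd) \<Rightarrow> bool" where
  "onb (u :: nat \<Rightarrow> complex ^ 'd) \<equiv> orthonormal CARD('d) u"

definition spec_mat :: "(nat \<Rightarrow> complex ^ 'd) \<Rightarrow> (nat \<Rightarrow> real) \<Rightarrow> complex ^ 'd ^ 'd" where
  "spec_mat u x = (\<Sum>j<CARD('d). x j *\<^sub>R rank_one (u j))"

text \<open>
Sequences of eigenvalues have to be sorted, so they are indexed by natural numbers, whereas the
entries of a matrix are indexed by a finite type that carries no order.
\<close>

definition index_of :: "'d::finite \<Rightarrow> nat" where
  "index_of = (SOME h. bij_betw h (UNIV :: 'd set) {..<CARD('d)})"

definition basis_mat :: "(nat \<Rightarrow> complex ^ 'd) \<Rightarrow> complex ^ 'd ^ 'd" where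
  "basis_mat u = (\<chi> i j. u (index_of j) $ i)"

lemma bij_index_of: "bij_betw (index_of :: 'd::finite \<Rightarrow> nat) UNIV {..<CARD('d)}"
proof -
  have "\<exists>h. bij_betw h (UNIV :: 'd set) {..<CARD('d)}"
    using ex_bij_betw_finite_nat[of "UNIV :: 'd set"] by (simp add: atLeast0LessThan)
  then show ?thesis unfolding index_of_def by (rule someI_ex)
qed

lemma index_of_less: "index_of (i :: 'd::finite) < CARD('d)"
  using bij_index_of[where 'd='d] by (auto simp: bij_betw_def)

lemma index_of_eq_iff [simp]: "index_of (i :: 'd::finite) = index_of j \<longleftrightarrow> i = j"
  using bij_index_of[where 'd='d] by (auto simp: bij_betw_def inj_on_def)

lemma unitary_basis_mat:
  fixes u :: "nat \<Rightarrow> complex ^ 'd"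
  assumes "onb u"
  shows "unitary_matrix (basis_mat u)"
proof -
  have "conj_transpose (basis_mat u) ** basis_mat u = mat 1"
  proof -
    have "(conj_transpose (basis_mat u) ** basis_mat u) $ i $ j = cinner (u (index_of i)) (u (index_of j))" for i j
      by (simp add: matrix_matrix_mult_def conj_transpose_def basis_mat_def cinner_def)
    then show ?thesis
      using assms index_of_less[where 'd='d]
      by (simp add: vec_eq_iff mat_def orthonormal_def)
  qed
  then show ?thesis
    unfolding unitary_matrix_def using matrix_left_right_inverse by blast
qed

text \<open>
This is what makes a unitarily invariant norm of \<open>spec_mat u x\<close> independent of \<open>u\<close>: the diagonal
factor involves \<open>x\<close> only.
\<close>

lemma spec_mat_eq_diag:
  fixes u :: "nat \<Rightarrow> complex ^ 'd"
  shows "spec_mat u x = basis_mat u ** diag_matrix (\<chi> i. of_real (x (index_of i))) ** conj_transpose (basis_mat u)"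
proof -
  have "(basis_mat u ** diag_matrix (\<chi> i. of_real (x (index_of i))) ** conj_transpose (basis_mat u)) $ i $ j
      = spec_mat u x $ i $ j" for i j
  proof -
    have "(basis_mat u ** diag_matrix (\<chi> i. of_real (x (index_of i))) ** conj_transpose (basis_mat u)) $ i $ j
       = (\<Sum>l\<in>(UNIV :: 'd set). u (index_of l) $ i * of_real (x (index_of l)) * cnj (u (index_of l) $ j))"
      by (simp add: matrix_matrix_mult_def conj_transpose_def basis_mat_def diag_matrix_def
          if_distrib[of "\<lambda>z. _ * z"] cong: if_cong)
    also have "\<dots> = (\<Sum>n<CARD('d). u n $ i * of_real (x n) * cnj (u n $ j))"
      by (rule sum.reindex_bij_betw[OF bij_index_of, of "\<lambda>n. u n $ i * of_real (x n) * cnj (u n $ j)"])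
    also have "\<dots> = spec_mat u x $ i $ j"
      by (simp add: spec_mat_def rank_one_def) (simp add: scaleR_conv_of_real mult_ac)
    finally show ?thesis .
  qed
  then show ?thesis by (simp add: vec_eq_iff)
qed

lemma onb_expansion:
  fixes u :: "nat \<Rightarrow> complex ^ 'd"
  assumes "onb u"
  shows "x = (\<Sum>j<CARD('d). cinner (u j) x *s u j)"
proof -
  have "diag_matrix (\<chi> i. of_real 1) = (mat 1 :: complex ^ 'd ^ 'd)"
    by (simp add: vec_eq_iff diag_matrix_def mat_def)
  then have "spec_mat u (\<lambda>_. 1) = mat 1"
    using unitary_basis_mat[OF assms] by (simp add: spec_mat_eq_diag unitary_matrix_def)
  then have "x = spec_mat u (\<lambda>_. 1) *v x" by simp
  then show ?thesis
    by (simp add: spec_mat_def sum_matrix_vector_mult rank_one_mult)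
qed

lemma onb_norm:
  fixes u :: "nat \<Rightarrow> complex ^ 'd"
  assumes "onb u"
  shows "(norm x)\<^sup>2 = (\<Sum>j<CARD('d). (cmod (cinner (u j) x))\<^sup>2)"
proof -
  have "cinner x x = cinner x (\<Sum>j<CARD('d). cinner (u j) x *s u j)"
    using onb_expansion[OF assms, of x] by simp
  also have "\<dots> = (\<Sum>j<CARD('d). cinner (u j) x * cnj (cinner (u j) x))"
    by (simp add: cinner_sum_right cinner_scale_right cinner_commute[of x])
  also have "\<dots> = of_real (\<Sum>j<CARD('d). (cmod (cinner (u j) x))\<^sup>2)"
    by (simp add: complex_norm_square[symmetric])
  finally show ?thesis by (simp only: cinner_self of_real_eq_iff)
qed

lemma onb_norm_1:
  fixes u :: "nat \<Rightarrow> complex ^ 'd"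
  assumes "onb u" "j < CARD('d)"
  shows "norm (u j) = 1"
proof -
  have "complex_of_real ((norm (u j))\<^sup>2) = of_real 1"
    using assms cinner_self[of "u j"] by (simp add: orthonormal_def)
  then have "(norm (u j))\<^sup>2 = 1\<^sup>2" by (simp only: of_real_eq_iff) simp
  then show ?thesis by (rule power2_eq_imp_eq) auto
qed

lemma spec_mat_eigen:
  fixes u :: "nat \<Rightarrow> complex ^ 'd"
  assumes "onb u" "j < CARD('d)"
  shows "spec_mat u x *v u j = x j *\<^sub>R u j"
proof -
  have "spec_mat u x *v u j = (\<Sum>i<CARD('d). if i = j then x j *\<^sub>R u j else 0)"
    unfolding spec_mat_def sum_matrix_vector_mult
    using assms by (intro sum.cong) (auto simp: scaleR_matrix_vector_mult rank_one_mult orthonormal_def)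
  then show ?thesis using assms by simp
qed

lemma eq_spec_mat:
  fixes u :: "nat \<Rightarrow> complex ^ 'd"
  assumes "onb u" "\<And>j. j < CARD('d) \<Longrightarrow> A *v u j = x j *\<^sub>R u j"
  shows "A = spec_mat u x"
proof -
  have "A *v y = spec_mat u x *v y" for y
  proof -
    have "A *v y = (\<Sum>j<CARD('d). A *v (cinner (u j) y *s u j))"
      using onb_expansion[OF assms(1), of y] by (metis matrix_vector_mult_sum)
    also have "\<dots> = (\<Sum>j<CARD('d). spec_mat u x *v (cinner (u j) y *s u j))"
      using assms by (intro sum.cong) (simp_all add: vector_scalar_commute spec_mat_eigen)
    also have "\<dots> = spec_mat u x *v y"
      using onb_expansion[OF assms(1), of y] by (metis matrix_vector_mult_sum)
    finally show ?thesis .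
  qed
  then show ?thesis by (simp add: matrix_eq)
qed

lemma spec_mat_diff: "spec_mat u x - spec_mat u y = spec_mat u (\<lambda>j. x j - y j)"
  by (simp add: spec_mat_def sum_subtractf scaleR_left_diff_distrib)

lemma spec_mat_cong:
  fixes u :: "nat \<Rightarrow> complex ^ 'd"
  shows "(\<And>j. j < CARD('d) \<Longrightarrow> x j = y j) \<Longrightarrow> spec_mat u x = spec_mat u y"
  by (simp add: spec_mat_def)

lemma unitary_change_basis:
  fixes u v :: "nat \<Rightarrow> complex ^ 'd"
  assumes "onb u" "onb v"
  obtains W where "unitary_matrix W" "\<And>x. W ** spec_mat u x ** conj_transpose W = spec_mat v x"
proof
  let ?W = "basis_mat v ** conj_transpose (basis_mat u)"
  have u: "conj_transpose (basis_mat u) ** basis_mat u = mat 1"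
      "basis_mat u ** conj_transpose (basis_mat u) = mat 1"
    and v: "conj_transpose (basis_mat v) ** basis_mat v = mat 1"
      "basis_mat v ** conj_transpose (basis_mat v) = mat 1"
    using unitary_basis_mat[OF assms(1)] unitary_basis_mat[OF assms(2)] by (auto simp: unitary_matrix_def)
  have cancel_u: "conj_transpose (basis_mat u) ** (basis_mat u ** X) = X"
    and cancel_u': "basis_mat u ** (conj_transpose (basis_mat u) ** X) = X"
    and cancel_v: "conj_transpose (basis_mat v) ** (basis_mat v ** X) = X" for X :: "complex ^ 'd ^ 'd"
    using u v by (simp_all add: matrix_mul_assoc)
  show "unitary_matrix ?W"
    using u v cancel_u cancel_u' cancel_v unfolding unitary_matrix_def
    by (simp add: conj_transpose_mult matrix_mul_assoc[symmetric])
  show "?W ** spec_mat u x ** conj_transpose ?W = spec_mat v x" for x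
    using u v cancel_u unfolding spec_mat_eq_diag
    by (simp add: conj_transpose_mult matrix_mul_assoc[symmetric])
qed

lemma unitary_norm:
  assumes "unitary_matrix W"
  shows "norm (W *v g) = norm g"
proof -
  have "cinner (W *v g) (W *v g) = cinner g g"
    using assms unfolding unitary_matrix_def
    by (metis cinner_conj_transpose conj_transpose_conj_transpose matrix_vector_mul_assoc matrix_vector_mul_lid)
  then have "(norm (W *v g))\<^sup>2 = (norm g)\<^sup>2" by (simp only: cinner_self of_real_eq_iff)
  then show ?thesis by simp
qed

section \<open>Common eigenbases with sorted eigenvalues\<close>

text \<open>
A maximizer \<open>x\<close> of the Rayleigh quotient on the unit sphere of \<open>V\<close>, with value \<open>r\<close>, is an eigenvector:
the form of \<open>B = r - A\<close> is nonnegative on \<open>V\<close> and vanishes at \<open>x\<close>, so its derivative at \<open>x\<close> in the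
direction \<open>B x\<close>, which is twice the squared norm of \<open>B x\<close>, must vanish.
\<close>

lemma rayleigh_eigenvector:
  fixes A :: "complex ^ 'd ^ 'd"
  assumes herm: "conj_transpose A = A" and V: "subspace V" "\<And>x. x \<in> V \<Longrightarrow> A *v x \<in> V"
    and ne: "z \<in> V" "z \<noteq> 0"
  obtains x r where "x \<in> V" "norm x = 1" "A *v x = r *\<^sub>R x"
    "\<And>y. y \<in> V \<Longrightarrow> y \<bullet> (A *v y) \<le> r * (norm y)\<^sup>2"
proof -
  let ?K = "V \<inter> sphere 0 1"
  have "compact ?K"
    using closed_subspace[OF V(1)] by (simp add: closed_Int_compact)
  moreover have "z /\<^sub>R norm z \<in> ?K"
    using ne V(1) by (simp add: subspace_scale)
  moreover have "continuous_on ?K (\<lambda>x. x \<bullet> (A *v x))"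
  proof -
    have "linear (\<lambda>x. A *v x)"
      by (intro linearI) (simp_all add: matrix_vector_right_distrib matrix_vector_mult_scaleR)
    then have "continuous_on ?K (\<lambda>x. A *v x)"
      by (simp add: linear_continuous_on linear_conv_bounded_linear)
    then show ?thesis by (intro continuous_intros)
  qed
  ultimately obtain x where x: "x \<in> ?K" and max: "\<And>y. y \<in> ?K \<Longrightarrow> y \<bullet> (A *v y) \<le> x \<bullet> (A *v x)"
    using continuous_attains_sup[of ?K] by blast
  define r where "r = x \<bullet> (A *v x)"
  have bound: "y \<bullet> (A *v y) \<le> r * (norm y)\<^sup>2" if "y \<in> V" for y
  proof (cases "y = 0")
    case False
    have "(y /\<^sub>R norm y) \<bullet> (A *v (y /\<^sub>R norm y)) \<le> r"
      unfolding r_def using that False V(1) by (intro max) (simp add: subspace_scale)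
    then show ?thesis
      using False by (simp add: matrix_vector_mult_scaleR field_simps power2_eq_square)
  qed simp
  define B where "B y = r *\<^sub>R y - A *v y" for y
  have Bpos: "0 \<le> y \<bullet> B y" if "y \<in> V" for y
    using bound[OF that] by (simp add: B_def inner_diff_right power2_norm_eq_inner)
  have Bx: "B x \<in> V"
    using x V by (auto simp: B_def intro!: subspace_diff subspace_scale)
  have nx: "norm x = 1" using x by simp
  then have "x \<bullet> x = 1" by (simp add: dot_square_norm)
  then have xB: "x \<bullet> B x = 0" by (simp add: B_def inner_diff_right r_def)
  have quad: "0 \<le> t * (2 * (norm (B x))\<^sup>2 + t * (B x \<bullet> B (B x)))" for t
  proof -
    have "x \<bullet> B y = B x \<bullet> y" for y
      by (simp add: B_def inner_diff_right inner_diff_left inner_hermitian[OF herm])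
    then have sym: "x \<bullet> B (B x) = B x \<bullet> B x" .
    have "B (y + t *\<^sub>R z) = B y + t *\<^sub>R B z" for y z
      by (simp add: B_def matrix_vector_right_distrib matrix_vector_mult_scaleR algebra_simps)
    then have "B (x + t *\<^sub>R B x) = B x + t *\<^sub>R B (B x)" .
    moreover have "0 \<le> (x + t *\<^sub>R B x) \<bullet> B (x + t *\<^sub>R B x)"
      using x Bx V(1) by (intro Bpos) (auto intro!: subspace_add subspace_scale)
    ultimately show ?thesis
      using xB sym by (simp add: inner_add_left inner_add_right power2_norm_eq_inner algebra_simps)
  qed
  have "B x = 0"
  proof (rule ccontr)
    assume "B x \<noteq> 0"
    define p where "p = (norm (B x))\<^sup>2"
    define q where "q = B x \<bullet> B (B x)"
    have p: "p > 0" using \<open>B x \<noteq> 0\<close> by (simp add: p_def)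
    \<comment> \<open>A negative \<open>t\<close> so small that the linear term of \<open>quad\<close> dominates the quadratic one.\<close>
    define t where "t = - p / (\<bar>q\<bar> + 1)"
    have t: "t < 0" using p by (simp add: t_def field_simps)
    have "\<bar>t * q\<bar> \<le> p"
      using p by (simp add: t_def abs_mult field_simps)
    then have "2 * p + t * q > 0" using p by linarith
    then have "t * (2 * p + t * q) < 0" using t by (simp add: mult_neg_pos)
    then show False using quad[of t] by (simp add: p_def q_def)
  qed
  then have "A *v x = r *\<^sub>R x" by (simp add: B_def)
  then show ?thesis using that[of x r] x nx bound by blast
qed

text \<open>
The two maxima are kept in the conclusion because they yield the lexicographic order of the
eigenvalue pairs in \<open>extend_eigenbasis\<close>.
\<close>

lemma common_eigenvector:
  fixes A B :: "complex ^ 'd ^ 'd"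
  assumes herm: "conj_transpose A = A" "conj_transpose B = B" and comm: "A ** B = B ** A"
    and V: "subspace V" "\<And>x. x \<in> V \<Longrightarrow> A *v x \<in> V" "\<And>x. x \<in> V \<Longrightarrow> B *v x \<in> V"
    and ne: "z \<in> V" "z \<noteq> 0"
  obtains x r s where "x \<in> V" "norm x = 1" "A *v x = r *\<^sub>R x" "B *v x = s *\<^sub>R x"
    "\<And>y. y \<in> V \<Longrightarrow> y \<bullet> (A *v y) \<le> r * (norm y)\<^sup>2"
    "\<And>y. y \<in> V \<Longrightarrow> A *v y = r *\<^sub>R y \<Longrightarrow> y \<bullet> (B *v y) \<le> s * (norm y)\<^sup>2"
proof -
  obtain x r where x: "x \<in> V" "norm x = 1" "A *v x = r *\<^sub>R x"
    and rmax: "\<And>y. y \<in> V \<Longrightarrow> y \<bullet> (A *v y) \<le> r * (norm y)\<^sup>2"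
    using rayleigh_eigenvector[OF herm(1) V(1,2) ne] by blast
  let ?E = "{y \<in> V. A *v y = r *\<^sub>R y}"
  have sub: "subspace ?E"
    using V(1) by (auto simp: subspace_def matrix_vector_right_distrib matrix_vector_mult_scaleR scaleR_add_right)
  have inv: "B *v y \<in> ?E" if "y \<in> ?E" for y
  proof -
    have "A *v (B *v y) = B *v (A *v y)"
      using comm by (simp add: matrix_vector_mul_assoc)
    then show ?thesis using that V(3) by (simp add: matrix_vector_mult_scaleR)
  qed
  have "x \<in> ?E" "x \<noteq> 0" using x by auto
  from rayleigh_eigenvector[OF herm(2) sub inv this]
  obtain x' s where "x' \<in> ?E" "norm x' = 1" "B *v x' = s *\<^sub>R x'"
    "\<And>y. y \<in> ?E \<Longrightarrow> y \<bullet> (B *v y) \<le> s * (norm y)\<^sup>2" by blast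
  then show ?thesis using that[of x' r s] rmax by blast
qed

text \<open>
Orthogonality over the complex numbers is real orthogonality to \<open>u i\<close> and to \<open>\<i> u i\<close>, and \<open>2 n\<close> real
vectors cannot span a space of real dimension \<open>2 CARD('d)\<close>.
\<close>

lemma ex_orthogonal_vector:
  fixes u :: "nat \<Rightarrow> complex ^ 'd"
  assumes "n < CARD('d)"
  obtains x where "x \<noteq> 0" "\<And>i. i < n \<Longrightarrow> cinner (u i) x = 0"
proof -
  let ?S = "u ` {..<n} \<union> (\<lambda>i. \<i> *s u i) ` {..<n}"
  have "dim ?S \<le> card ?S" by (rule dim_le_card') simp
  also have "\<dots> \<le> card (u ` {..<n}) + card ((\<lambda>i. \<i> *s u i) ` {..<n})"
    by (rule card_Un_le)
  also have "\<dots> \<le> n + n"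
    by (intro add_mono) (metis card_image_le finite_lessThan card_lessThan)+
  also have "\<dots> < DIM(complex ^ 'd)" using assms by simp
  finally obtain x where x: "x \<noteq> 0" "\<And>y. y \<in> span ?S \<Longrightarrow> orthogonal x y"
    using orthogonal_to_subspace_exists[of ?S] by blast
  have "cinner (u i) x = 0" if "i < n" for i
  proof -
    have "u i \<in> span ?S" "\<i> *s u i \<in> span ?S" using that by (auto intro!: span_base)
    then have "u i \<bullet> x = 0" "(\<i> *s u i) \<bullet> x = 0"
      using x(2) unfolding orthogonal_def by (metis inner_commute)+
    then have "Re (cinner (u i) x) = 0" "Re (cinner (\<i> *s u i) x) = 0"
      by (simp_all only: Re_cinner)
    then show ?thesis by (simp add: complex_eq_iff cinner_scale_left)
  qed
  then show ?thesis using that x(1) by blast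
qed

lemma ortho_complement:
  fixes A :: "complex ^ 'd ^ 'd"
  shows "subspace {x. \<forall>i<n. cinner (u i) x = 0}"
    and "conj_transpose A = A \<Longrightarrow> \<forall>i<n. A *v u i = r i *\<^sub>R u i \<Longrightarrow>
      x \<in> {x. \<forall>i<n. cinner (u i) x = 0} \<Longrightarrow> A *v x \<in> {x. \<forall>i<n. cinner (u i) x = 0}"
proof -
  show "subspace {x. \<forall>i<n. cinner (u i) x = 0}"
    by (auto simp: subspace_def cinner_simps)
  show "A *v x \<in> {x. \<forall>i<n. cinner (u i) x = 0}"
    if "conj_transpose A = A" "\<forall>i<n. A *v u i = r i *\<^sub>R u i" "x \<in> {x. \<forall>i<n. cinner (u i) x = 0}"
  proof -
    have "cinner (u i) (A *v x) = of_real (r i) * cinner (u i) x" if "i < n" for i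
      using cinner_hermitian[of A "u i" x] that \<open>\<forall>i<n. A *v u i = r i *\<^sub>R u i\<close> \<open>conj_transpose A = A\<close>
      by (simp add: cinner_scaleR_left)
    then show ?thesis using that by simp
  qed
qed

text \<open>
New eigenvectors are chosen greedily, each one maximizing the Rayleigh quotient of \<open>A\<close>, and then that
of \<open>B\<close>, on the orthogonal complement of the earlier ones.  These complements shrink, so the pairs of
eigenvalues come out in decreasing lexicographic order.  With \<open>m = 0\<close> this is a sorted simultaneous
diagonalization; with \<open>A = B\<close> and \<open>m = 2\<close> it puts two given eigenvectors into an eigenbasis.
\<close>

lemma extend_eigenbasis:
  fixes A B :: "complex ^ 'd ^ 'd"
  assumes herm: "conj_transpose A = A" "conj_transpose B = B" and comm: "A ** B = B ** A"
    and u: "orthonormal m u" "m \<le> CARD('d)"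
    and eig: "\<forall>i<m. A *v u i = \<alpha> i *\<^sub>R u i" "\<forall>i<m. B *v u i = \<beta> i *\<^sub>R u i"
  obtains v \<sigma> \<tau> where "onb v" "\<forall>i<m. v i = u i \<and> \<sigma> i = \<alpha> i \<and> \<tau> i = \<beta> i"
    "A = spec_mat v \<sigma>" "B = spec_mat v \<tau>"
    "\<And>i j. m \<le> i \<Longrightarrow> i < j \<Longrightarrow> j < CARD('d) \<Longrightarrow> \<sigma> j \<le> \<sigma> i"
    "\<And>i j. m \<le> i \<Longrightarrow> i < j \<Longrightarrow> j < CARD('d) \<Longrightarrow> \<sigma> i = \<sigma> j \<Longrightarrow> \<tau> j \<le> \<tau> i"
proof -
  let ?V = "\<lambda>v i. {x. \<forall>l<i. cinner (v l) x = 0}"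
  define P where "P n v \<sigma> \<tau> \<longleftrightarrow> orthonormal n v \<and> (\<forall>i<m. v i = u i \<and> \<sigma> i = \<alpha> i \<and> \<tau> i = \<beta> i) \<and>
    (\<forall>i<n. A *v v i = \<sigma> i *\<^sub>R v i) \<and> (\<forall>i<n. B *v v i = \<tau> i *\<^sub>R v i) \<and>
    (\<forall>i. m \<le> i \<longrightarrow> i < n \<longrightarrow> (\<forall>y\<in>?V v i. y \<bullet> (A *v y) \<le> \<sigma> i * (norm y)\<^sup>2 \<and>
        (A *v y = \<sigma> i *\<^sub>R y \<longrightarrow> y \<bullet> (B *v y) \<le> \<tau> i * (norm y)\<^sup>2)))"
    for n and v :: "nat \<Rightarrow> complex ^ 'd" and \<sigma> \<tau> :: "nat \<Rightarrow> real"
  have "\<exists>v \<sigma> \<tau>. P CARD('d) v \<sigma> \<tau>"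
    using u(2)
  proof (induction rule: dec_induct)
    case base
    show ?case
      by (rule exI[of _ u], rule exI[of _ \<alpha>], rule exI[of _ \<beta>]) (use u eig in \<open>simp add: P_def\<close>)
  next
    case (step n)
    then obtain v \<sigma> \<tau> where P: "P n v \<sigma> \<tau>" by blast
    then have v: "orthonormal n v" "\<forall>i<n. A *v v i = \<sigma> i *\<^sub>R v i" "\<forall>i<n. B *v v i = \<tau> i *\<^sub>R v i"
      by (auto simp: P_def)
    obtain z where "z \<noteq> 0" "\<And>i. i < n \<Longrightarrow> cinner (v i) z = 0"
      using ex_orthogonal_vector[OF step(2), of v] by blast
    then have z: "z \<in> ?V v n" "z \<noteq> 0" by auto
    obtain x r s where x: "x \<in> ?V v n" "norm x = 1" "A *v x = r *\<^sub>R x" "B *v x = s *\<^sub>R x"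
      and mx: "\<And>y. y \<in> ?V v n \<Longrightarrow> y \<bullet> (A *v y) \<le> r * (norm y)\<^sup>2"
        "\<And>y. y \<in> ?V v n \<Longrightarrow> A *v y = r *\<^sub>R y \<Longrightarrow> y \<bullet> (B *v y) \<le> s * (norm y)\<^sup>2"
      using common_eigenvector[OF herm comm ortho_complement(1)
          ortho_complement(2)[OF herm(1) v(2)] ortho_complement(2)[OF herm(2) v(3)] z] by blast
    let ?v = "v(n := x)" and ?\<sigma> = "\<sigma>(n := r)" and ?\<tau> = "\<tau>(n := s)"
    have xx: "cinner x x = 1" using x(2) by (simp add: cinner_self)
    have xv: "cinner (v i) x = 0" "cinner x (v i) = 0" if "i < n" for i
      using x(1) that cinner_commute[of x "v i"] by auto
    have "orthonormal (Suc n) ?v"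
      using v(1) xx xv by (auto simp: orthonormal_def less_Suc_eq)
    moreover have "?V ?v i = ?V v i" if "i \<le> n" for i
      using that by auto
    moreover have "\<forall>i<m. ?v i = u i \<and> ?\<sigma> i = \<alpha> i \<and> ?\<tau> i = \<beta> i"
      using P step(1) by (auto simp: P_def)
    ultimately have "P (Suc n) ?v ?\<sigma> ?\<tau>"
      unfolding P_def using P mx x(3,4) step(1)
      by (intro conjI) (auto simp: less_Suc_eq P_def)
    then show ?case by blast
  qed
  then obtain v \<sigma> \<tau> where P: "P CARD('d) v \<sigma> \<tau>" by blast
  then have v: "onb v" by (simp add: P_def)
  have nv: "norm (v j) = 1" if "j < CARD('d)" for j
    using onb_norm_1[OF v that] .
  have mem: "v j \<in> ?V v i" if "i < j" "j < CARD('d)" for i j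
    using v that by (auto simp: orthonormal_def)
  have eA: "A *v v j = \<sigma> j *\<^sub>R v j" and eB: "B *v v j = \<tau> j *\<^sub>R v j" if "j < CARD('d)" for j
    using P that by (auto simp: P_def)
  have ray: "v j \<bullet> (A *v v j) = \<sigma> j" "v j \<bullet> (B *v v j) = \<tau> j" if "j < CARD('d)" for j
    using eA eB nv that by (simp_all add: dot_square_norm)
  show ?thesis
  proof (rule that[of v \<sigma> \<tau>])
    show "A = spec_mat v \<sigma>" by (rule eq_spec_mat[OF v eA])
    show "B = spec_mat v \<tau>" by (rule eq_spec_mat[OF v eB])
    show "\<forall>i<m. v i = u i \<and> \<sigma> i = \<alpha> i \<and> \<tau> i = \<beta> i" using P by (simp add: P_def)
    fix i j assume ij: "m \<le> i" "i < j" "j < CARD('d)"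
    then have *: "v j \<bullet> (A *v v j) \<le> \<sigma> i * (norm (v j))\<^sup>2"
        "A *v v j = \<sigma> i *\<^sub>R v j \<Longrightarrow> v j \<bullet> (B *v v j) \<le> \<tau> i * (norm (v j))\<^sup>2"
      using P mem[OF ij(2,3)] unfolding P_def by (meson order_less_trans)+
    show "\<sigma> j \<le> \<sigma> i" using *(1) ray nv ij by simp
    show "\<tau> j \<le> \<tau> i" if "\<sigma> i = \<sigma> j" using *(2) ray nv ij eA that by simp
  qed (use v in auto)
qed

section \<open>Sums of the largest eigenvalues\<close>

text \<open>
Subtracting \<open>x (p - 1)\<close> from all entries makes those before position \<open>p\<close> nonnegative and the others
nonpositive, so moving every weight to 1 or 0 accordingly can only increase the sum.  The hypothesis on
the total weight accounts for the subtracted constant.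
\<close>

lemma weighted_sum_le_top_sum:
  fixes x w :: "nat \<Rightarrow> real"
  assumes dec: "\<And>i j. i < j \<Longrightarrow> j < d \<Longrightarrow> x j \<le> x i"
    and w: "\<And>j. j < d \<Longrightarrow> 0 \<le> w j" "\<And>j. j < d \<Longrightarrow> w j \<le> 1" and p: "p \<le> d"
    and tot: "(\<Sum>j<d. w j) = real p \<or> (\<Sum>j<d. w j) \<le> real p \<and> (\<forall>j<d. 0 \<le> x j)"
  shows "(\<Sum>j<d. w j * x j) \<le> (\<Sum>j<p. x j)"
proof (cases "p = 0")
  case True
  then have "(\<Sum>j<d. w j) = 0"
    using tot sum_nonneg[of "{..<d}" w] w(1) by fastforce
  then have "\<forall>j<d. w j = 0"
    using w(1) by (subst (asm) sum_nonneg_eq_0_iff) auto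
  then show ?thesis using True by simp
next
  case False
  define c where "c = x (p - 1)"
  have cle: "c \<le> x j" if "j < p" for j
    using that dec[of j "p - 1"] p by (cases "j = p - 1") (auto simp: c_def)
  have cge: "x j \<le> c" if "p \<le> j" "j < d" for j
    using that dec[of "p - 1" j] False by (auto simp: c_def)
  have "(\<Sum>j<d. w j * (x j - c)) \<le> (\<Sum>j<d. if j < p then x j - c else 0)"
  proof (rule sum_mono)
    fix j assume "j \<in> {..<d}"
    then show "w j * (x j - c) \<le> (if j < p then x j - c else 0)"
      using w[of j] cle[of j] cge[of j]
      by (auto simp: mult_left_le_one_le mult_nonneg_nonpos)
  qed
  also have "\<dots> = (\<Sum>j<p. x j - c)"
    using p by (simp add: sum.If_cases Int_absorb1 lessThan_def[symmetric])
  finally have "(\<Sum>j<d. w j * x j) - c * (\<Sum>j<d. w j) \<le> (\<Sum>j<p. x j) - c * real p"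
    by (simp add: algebra_simps sum_subtractf sum_distrib_left)
  moreover have "c * (\<Sum>j<d. w j) \<le> c * real p"
    using tot
  proof
    assume "(\<Sum>j<d. w j) \<le> real p \<and> (\<forall>j<d. 0 \<le> x j)"
    then show ?thesis using False p by (intro mult_left_mono) (auto simp: c_def)
  qed simp
  ultimately show ?thesis by linarith
qed

lemma inner_spec_mat:
  fixes u :: "nat \<Rightarrow> complex ^ 'd"
  shows "y \<bullet> (spec_mat u x *v y) = (\<Sum>j<CARD('d). x j * (cmod (cinner (u j) y))\<^sup>2)"
proof -
  have "cinner y (spec_mat u x *v y) = (\<Sum>j<CARD('d). of_real (x j) * (cinner (u j) y * cnj (cinner (u j) y)))"
    by (simp add: spec_mat_def sum_matrix_vector_mult scaleR_matrix_vector_mult rank_one_mult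
        cinner_sum_right cinner_simps cinner_commute[of y])
  also have "\<dots> = of_real (\<Sum>j<CARD('d). x j * (cmod (cinner (u j) y))\<^sup>2)"
    by (simp add: complex_norm_square[symmetric])
  finally show ?thesis by (metis Re_cinner Re_complex_of_real)
qed

text \<open>
Ky Fan's maximum principle: the diagonal entries of the matrix in the basis \<open>v\<close> are averages of its
eigenvalues with doubly stochastic weights.
\<close>

lemma sorted_spectrum_prefix_le:
  fixes u v :: "nat \<Rightarrow> complex ^ 'd"
  assumes u: "onb u" and v: "onb v" and eq: "spec_mat u x = spec_mat v y"
    and dec: "\<And>i j. i < j \<Longrightarrow> j < CARD('d) \<Longrightarrow> x j \<le> x i" and p: "p \<le> CARD('d)"
  shows "(\<Sum>j<p. y j) \<le> (\<Sum>j<p. x j)"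
proof -
  define w where "w i = (\<Sum>j<p. (cmod (cinner (u i) (v j)))\<^sup>2)" for i
  have cm: "cmod (cinner (v j) (u i)) = cmod (cinner (u i) (v j))" for i j
    by (subst cinner_commute) simp
  have "y j = v j \<bullet> (spec_mat u x *v v j)" if "j < p" for j
    using that p onb_norm_1[OF v, of j] by (simp add: eq spec_mat_eigen[OF v] dot_square_norm)
  then have "(\<Sum>j<p. y j) = (\<Sum>j<p. \<Sum>i<CARD('d). x i * (cmod (cinner (u i) (v j)))\<^sup>2)"
    by (simp add: inner_spec_mat)
  also have "\<dots> = (\<Sum>i<CARD('d). w i * x i)"
    by (subst sum.swap) (simp add: w_def sum_distrib_left mult.commute)
  also have "\<dots> \<le> (\<Sum>j<p. x j)"
  proof (rule weighted_sum_le_top_sum[OF dec _ _ p])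
    show "0 \<le> w i" for i by (simp add: w_def sum_nonneg)
    show "w i \<le> 1" if "i < CARD('d)" for i
    proof -
      have "w i \<le> (\<Sum>j<CARD('d). (cmod (cinner (v j) (u i)))\<^sup>2)"
        unfolding w_def cm using p by (intro sum_mono2) auto
      then show ?thesis using onb_norm[OF v, of "u i"] onb_norm_1[OF u that] by simp
    qed
    have "(\<Sum>i<CARD('d). w i) = (\<Sum>j<p. (norm (v j))\<^sup>2)"
      unfolding w_def by (subst sum.swap) (simp add: onb_norm[OF u])
    also have "\<dots> = real p" using p onb_norm_1[OF v] by simp
    finally show "(\<Sum>i<CARD('d). w i) = real p \<or> (\<Sum>i<CARD('d). w i) \<le> real p \<and> (\<forall>j<CARD('d). 0 \<le> x j)"
      by simp
  qed auto
  finally show ?thesis .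
qed

lemma sorted_spectrum_unique:
  fixes u v :: "nat \<Rightarrow> complex ^ 'd"
  assumes u: "onb u" and v: "onb v" and eq: "spec_mat u x = spec_mat v y"
    and dx: "\<And>i j. i < j \<Longrightarrow> j < CARD('d) \<Longrightarrow> x j \<le> x i"
    and dy: "\<And>i j. i < j \<Longrightarrow> j < CARD('d) \<Longrightarrow> y j \<le> y i" and j: "j < CARD('d)"
  shows "x j = y j"
proof -
  have "(\<Sum>j<p. x j) = (\<Sum>j<p. y j)" if "p \<le> CARD('d)" for p
    using sorted_spectrum_prefix_le[OF u v eq dx that] sorted_spectrum_prefix_le[OF v u eq[symmetric] dy that]
    by linarith
  from this[of j] this[of "Suc j"] j show ?thesis by simp
qed

section \<open>The possible spectra of frame operators\<close>

definition ranking :: "nat \<Rightarrow> (nat \<Rightarrow> real) \<Rightarrow> nat list" where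
  "ranking k a = sort_key (\<lambda>i. - a i) [1..<Suc k]"

definition top_sum :: "nat \<Rightarrow> (nat \<Rightarrow> real) \<Rightarrow> nat \<Rightarrow> real" where
  "top_sum k a p = sum_list (map a (take p (ranking k a)))"

text \<open>
For decreasing \<open>x\<close> this says that \<open>x\<close> majorizes \<open>a\<close>, both padded with zeros.  The prefix sums are taken
in the given order of the indices, without sorting \<open>x\<close>, so that the set of all such \<open>x\<close> is a polytope
in which exchanges between two coordinates are easy to control.
\<close>

definition feasible :: "nat \<Rightarrow> nat \<Rightarrow> (nat \<Rightarrow> real) \<Rightarrow> (nat \<Rightarrow> real) \<Rightarrow> bool" where
  "feasible d k a x \<longleftrightarrow> (\<forall>j<d. 0 \<le> x j) \<and> (\<forall>p\<le>d. top_sum k a p \<le> (\<Sum>j<p. x j)) \<and>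
     (\<Sum>j<d. x j) = (\<Sum>i=1..k. a i)"

lemma set_ranking [simp]: "set (ranking k a) = {1..k}"
  by (auto simp: ranking_def)

lemma distinct_ranking [simp]: "distinct (ranking k a)"
  by (simp add: ranking_def)

lemma length_ranking [simp]: "length (ranking k a) = k"
  by (simp add: ranking_def)

lemma sorted_ranking: "sorted_wrt (\<lambda>i j. a j \<le> a i) (ranking k a)"
proof -
  have "sorted_wrt (\<le>) (map (\<lambda>i. - a i) (ranking k a))"
    unfolding ranking_def by (rule sorted_sort_key)
  then show ?thesis by (simp add: sorted_wrt_map)
qed

lemma top_sum_eq_total: "k \<le> p \<Longrightarrow> top_sum k a p = (\<Sum>i=1..k. a i)"
  by (simp add: top_sum_def sum_list_distinct_conv_sum_set)

lemma sum_list_separated_le: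
  fixes f :: "'a \<Rightarrow> real"
  assumes "length xs = length ys" "\<forall>x\<in>set xs. f x \<le> c" "\<forall>y\<in>set ys. c \<le> g y"
  shows "sum_list (map f xs) \<le> sum_list (map g ys)"
  using assms by (induction xs ys rule: list_induct2) force+

lemma sum_list_separated_less:
  fixes f :: "'a \<Rightarrow> real"
  assumes "length xs = length ys" "xs \<noteq> []" "\<forall>x\<in>set xs. f x \<le> c" "\<forall>y\<in>set ys. c < g y"
  shows "sum_list (map f xs) < sum_list (map g ys)"
proof -
  obtain x xs' y ys' where *: "xs = x # xs'" "ys = y # ys'"
    using assms(1,2) by (metis length_0_conv list.exhaust)
  have "sum_list (map f xs') \<le> sum_list (map g ys')"
    using assms * by (intro sum_list_separated_le[of _ _ _ c]) auto
  moreover have "f x < g y" using assms * by fastforce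
  ultimately show ?thesis using * by simp
qed

text \<open>
Replacing two orthogonal vectors by a rotated pair preserves the sum of their rank-one matrices, while
the squared norm of the first vector takes every value between the two original ones.
\<close>

lemma rotate_to_norm:
  fixes v w :: "complex ^ 'd"
  assumes orth: "cinner v w = 0" and le: "(norm w)\<^sup>2 \<le> a" "a \<le> (norm v)\<^sup>2"
  obtains c s where "(norm (c *\<^sub>R v + s *\<^sub>R w))\<^sup>2 = a"
    "(norm (- s *\<^sub>R v + c *\<^sub>R w))\<^sup>2 = (norm v)\<^sup>2 + (norm w)\<^sup>2 - a"
    "rank_one (c *\<^sub>R v + s *\<^sub>R w) + rank_one (- s *\<^sub>R v + c *\<^sub>R w) = rank_one v + rank_one w"
proof -
  have "\<exists>q\<ge>0. q \<le> 1 \<and> q * B + (1 - q) * A = a" if "A \<le> a" "a \<le> B" for A B :: real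
  proof (cases "A = B")
    case True
    then show ?thesis using that by (intro exI[of _ 1]) simp
  next
    case False
    then have "A < B" using that by simp
    moreover have "(a - A) / (B - A) * B + (1 - (a - A) / (B - A)) * A = A + (a - A) / (B - A) * (B - A)"
      by (simp only: algebra_simps)
    ultimately show ?thesis
      using that by (intro exI[of _ "(a - A) / (B - A)"]) simp
  qed
  from this[OF le] obtain q where q: "0 \<le> q" "q \<le> 1" "q * (norm v)\<^sup>2 + (1 - q) * (norm w)\<^sup>2 = a"
    by blast
  have vw: "v \<bullet> w = 0" using orth Re_cinner[of v w] by simp
  have nn: "(norm (b *\<^sub>R v + e *\<^sub>R w))\<^sup>2 = b\<^sup>2 * (norm v)\<^sup>2 + e\<^sup>2 * (norm w)\<^sup>2" for b e
    using vw unfolding power2_norm_eq_inner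
    by (simp add: inner_add_left inner_add_right inner_commute[of w v] power2_eq_square)
  show ?thesis
  proof (rule that[of "sqrt q" "sqrt (1 - q)"])
    show "(norm (sqrt q *\<^sub>R v + sqrt (1 - q) *\<^sub>R w))\<^sup>2 = a"
      using q by (simp add: nn)
    show "(norm (- sqrt (1 - q) *\<^sub>R v + sqrt q *\<^sub>R w))\<^sup>2 = (norm v)\<^sup>2 + (norm w)\<^sup>2 - a"
      unfolding nn using q(1,2) q(3)[symmetric] by (simp add: algebra_simps)
    show "rank_one (sqrt q *\<^sub>R v + sqrt (1 - q) *\<^sub>R w) + rank_one (- sqrt (1 - q) *\<^sub>R v + sqrt q *\<^sub>R w)
        = rank_one v + rank_one w"
      unfolding rank_one_comb using q by (simp add: algebra_simps)
  qed
qed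

text \<open>
The constructive half of the Schur-Horn theorem.  The largest prescribed norm is realized first, by
rotating the first vector \<open>v\<close> with the first vector \<open>w\<close> of the remaining list whose squared norm does
not exceed it.  The second vector of the rotated pair takes the place of \<open>w\<close>; it is orthogonal to all
other remaining vectors.  The prefix conditions survive: the squared norms before the position of \<open>w\<close>
exceed every prescribed value, and the prefix sums from that position on are the old ones minus the
value just realized.
\<close>

lemma horn_list:
  fixes vs :: "(complex ^ 'd) list"
  assumes "length vs = length is" "sorted_wrt (\<lambda>i j. a j \<le> a i) is" "distinct is"
    "sorted_wrt (\<lambda>x y. cinner x y = 0) vs"
    "\<And>p. p \<le> length is \<Longrightarrow>
       sum_list (map a (take p is)) \<le> sum_list (map (\<lambda>v. (norm v)\<^sup>2) (take p vs))"
    "sum_list (map a is) = sum_list (map (\<lambda>v. (norm v)\<^sup>2) vs)"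
  shows "\<exists>g. (\<forall>i\<in>set is. (norm (g i))\<^sup>2 = a i) \<and>
    (\<Sum>i\<in>set is. rank_one (g i)) = sum_list (map rank_one vs)"
  using assms
proof (induction "is" arbitrary: vs)
  case Nil
  then show ?case by simp
next
  case (Cons i "is")
  let ?n = "\<lambda>v :: complex ^ 'd. (norm v)\<^sup>2"
  obtain v ws where vs: "vs = v # ws" using Cons.prems(1) by (cases vs) auto
  have len: "length ws = length is" using Cons.prems(1) vs by simp
  have av: "a i \<le> ?n v" using Cons.prems(5)[of 1] vs by simp
  have ai: "\<forall>j\<in>set is. a j \<le> a i" using Cons.prems(2) by simp
  have tot: "a i + sum_list (map a is) = ?n v + sum_list (map ?n ws)"
    using Cons.prems(6) vs by simp
  show ?case
  proof (cases "is = []")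
    case True
    then show ?thesis using tot len vs by (intro exI[of _ "\<lambda>_. v"]) simp
  next
    case False
    have "\<exists>w\<in>set ws. ?n w \<le> a i"
    proof (rule ccontr)
      assume "\<not> ?thesis"
      then have "sum_list (map a is) < sum_list (map ?n ws)"
        using len False ai by (intro sum_list_separated_less[of _ _ _ "a i"]) (auto simp: not_le)
      then show False using tot av by linarith
    qed
    then obtain xs w ys where ws: "ws = xs @ w # ys" "?n w \<le> a i" "\<forall>x\<in>set xs. \<not> ?n x \<le> a i"
      using split_list_first_prop[of ws "\<lambda>w. ?n w \<le> a i"] by blast
    have orth: "cinner v w = 0" "\<forall>x\<in>set xs. cinner v x = 0" "\<forall>y\<in>set ys. cinner v y = 0"
      "\<forall>x\<in>set xs. cinner x w = 0" "\<forall>y\<in>set ys. cinner w y = 0"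
      "sorted_wrt (\<lambda>x y. cinner x y = 0) xs" "sorted_wrt (\<lambda>x y. cinner x y = 0) ys"
      "\<forall>x\<in>set xs. \<forall>y\<in>set ys. cinner x y = 0"
      using Cons.prems(4) by (auto simp: vs ws sorted_wrt_append)
    obtain c s where g: "?n (c *\<^sub>R v + s *\<^sub>R w) = a i"
      "?n (- s *\<^sub>R v + c *\<^sub>R w) = ?n v + ?n w - a i"
      "rank_one (c *\<^sub>R v + s *\<^sub>R w) + rank_one (- s *\<^sub>R v + c *\<^sub>R w) = rank_one v + rank_one w"
      using rotate_to_norm[OF orth(1) ws(2) av] by blast
    define v' where "v' = - s *\<^sub>R v + c *\<^sub>R w"
    have vx: "cinner x v = 0" if "x \<in> set xs" for x
      using orth(2) that cinner_commute[of x v] by simp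
    have "\<exists>g. (\<forall>i\<in>set is. ?n (g i) = a i) \<and>
        (\<Sum>i\<in>set is. rank_one (g i)) = sum_list (map rank_one (xs @ v' # ys))"
    proof (rule Cons.IH)
      show "length (xs @ v' # ys) = length is" using len ws by simp
      show "sorted_wrt (\<lambda>i j. a j \<le> a i) is" "distinct is" using Cons.prems by auto
      show "sorted_wrt (\<lambda>x y. cinner x y = 0) (xs @ v' # ys)"
        using orth vx by (auto simp: sorted_wrt_append v'_def cinner_simps)
      show "sum_list (map a is) = sum_list (map ?n (xs @ v' # ys))"
        using tot g(2) by (simp add: ws v'_def)
      fix p assume p: "p \<le> length is"
      show "sum_list (map a (take p is)) \<le> sum_list (map ?n (take p (xs @ v' # ys)))"
      proof (cases "p \<le> length xs")
        case True
        have "sum_list (map a (take p is)) \<le> sum_list (map ?n (take p xs))"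
          using True p ai ws(3)
          by (intro sum_list_separated_le[of _ _ _ "a i"]) (auto dest!: in_set_takeD)
        then show ?thesis using True by simp
      next
        case False
        then obtain m where m: "p = Suc (length xs + m)"
          by (metis add_Suc_right less_imp_Suc_add not_le)
        have "sum_list (map a (take (Suc p) (i # is))) \<le> sum_list (map ?n (take (Suc p) vs))"
          using p by (intro Cons.prems(5)) simp
        then show ?thesis
          using g(2) by (simp add: m vs ws v'_def)
      qed
    qed
    then obtain h where h: "\<forall>i\<in>set is. ?n (h i) = a i"
      "(\<Sum>i\<in>set is. rank_one (h i)) = sum_list (map rank_one (xs @ v' # ys))" by blast
    define h' where "h' = h(i := c *\<^sub>R v + s *\<^sub>R w)"
    have "i \<notin> set is" using Cons.prems(3) by simp
    then have "(\<Sum>j\<in>set is. rank_one (h' j)) = (\<Sum>j\<in>set is. rank_one (h j))"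
      by (intro sum.cong) (auto simp: h'_def)
    then have "(\<Sum>j\<in>set (i # is). rank_one (h' j)) = sum_list (map rank_one vs)"
      using \<open>i \<notin> set is\<close> h(2) g(3) by (simp add: h'_def vs ws v'_def algebra_simps)
    moreover have "\<forall>j\<in>set (i # is). ?n (h' j) = a j" using h(1) g(1) by (simp add: h'_def)
    ultimately show ?thesis by blast
  qed
qed

text \<open>
The vectors \<open>sqrt (x j) u j\<close> are padded with zeros if \<open>k\<close> exceeds the dimension.  If \<open>k\<close> is smaller, the
prefix sum of length \<open>k\<close> already exhausts the total, so the remaining \<open>x j\<close> vanish.
\<close>

lemma feasible_imp_frame_operator:
  fixes u :: "nat \<Rightarrow> complex ^ 'd"
  assumes u: "onb u" and pos: "\<forall>i\<in>{1..k}. 0 < a i" and x: "feasible CARD('d) k a x"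
  shows "spec_mat u x \<in> frame_operators k a"
proof -
  let ?d = "CARD('d)"
  define v where "v j = (if j < ?d then sqrt (x j) *\<^sub>R u j else 0)" for j
  have x0: "\<And>j. j < ?d \<Longrightarrow> 0 \<le> x j" and pre: "\<And>p. p \<le> ?d \<Longrightarrow> top_sum k a p \<le> (\<Sum>j<p. x j)"
    and tot: "(\<Sum>j<?d. x j) = (\<Sum>i=1..k. a i)"
    using x by (auto simp: feasible_def)
  have zero: "x j = 0" if "k \<le> j" "j < ?d" for j
  proof -
    have "(\<Sum>j<?d. x j) = (\<Sum>j<k. x j) + (\<Sum>j=k..<?d. x j)"
      using that by (simp add: sum.atLeastLessThan_concat[of 0 k ?d x, symmetric, simplified atLeast0LessThan])
    moreover have "(\<Sum>i=1..k. a i) \<le> (\<Sum>j<k. x j)"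
      using pre[of k] that top_sum_eq_total[of k k a] by simp
    ultimately have "(\<Sum>j=k..<?d. x j) = 0"
      using tot sum_nonneg[of "{k..<?d}" x] x0 by fastforce
    then show ?thesis using that x0 by (subst (asm) sum_nonneg_eq_0_iff) auto
  qed
  have nv: "(norm (v j))\<^sup>2 = (if j < ?d then x j else 0)" for j
    using onb_norm_1[OF u, of j] x0 by (simp add: v_def)
  have orth: "cinner (v i) (v j) = 0" if "i \<noteq> j" for i j
    using that u by (auto simp: v_def cinner_simps orthonormal_def)
  have sum_nv: "sum_list (map (\<lambda>v. (norm v)\<^sup>2) (take p (map v [0..<k]))) = (\<Sum>j<min p ?d. x j)"
    if "p \<le> k" for p
  proof -
    have "sum_list (map (\<lambda>v. (norm v)\<^sup>2) (take p (map v [0..<k]))) = (\<Sum>j<p. if j < ?d then x j else 0)"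
      using that by (simp add: take_map take_upt comp_def nv sum_list_distinct_conv_sum_set atLeast0LessThan)
    also have "\<dots> = (\<Sum>j<min p ?d. x j)"
      by (rule sum.mono_neutral_cong_right) auto
    finally show ?thesis .
  qed
  have totk: "(\<Sum>j<min k ?d. x j) = (\<Sum>i=1..k. a i)"
    unfolding tot[symmetric] using zero by (intro sum.mono_neutral_left) auto
  have ex: "\<exists>g. (\<forall>i\<in>set (ranking k a). (norm (g i))\<^sup>2 = a i) \<and>
      (\<Sum>i\<in>set (ranking k a). rank_one (g i)) = sum_list (map rank_one (map v [0..<k]))"
  proof (rule horn_list)
    show "sorted_wrt (\<lambda>x y. cinner x y = 0) (map v [0..<k])"
      by (simp add: sorted_wrt_iff_nth_less orth)
    show "sum_list (map a (ranking k a)) = sum_list (map (\<lambda>v. (norm v)\<^sup>2) (map v [0..<k]))"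
      using sum_nv[of k] totk by (simp add: sum_list_distinct_conv_sum_set)
    fix p assume "p \<le> length (ranking k a)"
    then have p: "p \<le> k" by simp
    have "sum_list (map a (take p (ranking k a))) \<le> (\<Sum>j<min p ?d. x j)"
    proof (cases "p \<le> ?d")
      case True
      then show ?thesis using pre[of p] by (simp add: top_sum_def min_def)
    next
      case False
      have "set (take p (ranking k a)) \<subseteq> {1..k}"
        using set_take_subset[of p "ranking k a"] by simp
      then have "sum_list (map a (take p (ranking k a))) \<le> (\<Sum>i=1..k. a i)"
        using pos by (simp add: sum_list_distinct_conv_sum_set) (intro sum_mono2, auto intro: less_imp_le)
      then show ?thesis using False tot by (simp add: min_def)
    qed
    then show "sum_list (map a (take p (ranking k a))) \<le> sum_list (map (\<lambda>v. (norm v)\<^sup>2) (take p (map v [0..<k])))"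
      using sum_nv[OF p] by simp
  qed (use sorted_ranking in auto)
  then obtain g where g: "\<forall>i\<in>{1..k}. (norm (g i))\<^sup>2 = a i"
      "(\<Sum>i=1..k. rank_one (g i)) = sum_list (map rank_one (map v [0..<k]))" by auto
  have "sum_list (map rank_one (map v [0..<k])) = (\<Sum>j<k. if j < ?d then x j *\<^sub>R rank_one (u j) else 0)"
    using x0 by (auto simp: comp_def sum_list_distinct_conv_sum_set atLeast0LessThan v_def rank_one_scaleR
        intro!: sum.cong) (simp add: rank_one_def vec_eq_iff)
  also have "\<dots> = spec_mat u x"
    unfolding spec_mat_def using zero by (intro sum.mono_neutral_cong) auto
  finally have "spec_mat u x = frame_operator k g" by (simp only: frame_operator_def g(2))
  with g(1) show ?thesis unfolding frame_operators_def by blast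
qed

lemma inner_frame_operator:
  "y \<bullet> (frame_operator k g *v y) = (\<Sum>i=1..k. (cmod (cinner y (g i)))\<^sup>2)"
proof -
  have "cinner y (frame_operator k g *v y) = (\<Sum>i=1..k. cinner y (g i) * cnj (cinner y (g i)))"
    by (simp add: frame_operator_def sum_matrix_vector_mult rank_one_mult
        cinner_sum_right cinner_simps cinner_commute[of _ y] mult.commute)
  also have "\<dots> = of_real (\<Sum>i=1..k. (cmod (cinner y (g i)))\<^sup>2)"
    by (simp add: complex_norm_square[symmetric])
  finally show ?thesis by (metis Re_cinner Re_complex_of_real)
qed

text \<open>
The other half of the Schur-Horn theorem.  With \<open>m j i\<close> the squared modulus of the coefficient of \<open>g i\<close>
at \<open>u j\<close>, the row sums of \<open>m\<close> are the eigenvalues and the column sums are the prescribed norms.  The sum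
of some \<open>a i\<close> over a set \<open>I\<close> of at most \<open>p\<close> indices is therefore a sum of the \<open>x j\<close> with weights \<open>w j\<close> in
the unit interval, and these have total at most \<open>p\<close> because \<open>g i\<close> has length at most one in the
pseudo-inverse form of the frame operator: this operator dominates the rank-one matrix of \<open>g i\<close>.
\<close>

lemma frame_operator_imp_feasible:
  fixes u :: "nat \<Rightarrow> complex ^ 'd"
  assumes u: "onb u" and T: "spec_mat u x \<in> frame_operators k a"
    and dec: "\<And>i j. i < j \<Longrightarrow> j < CARD('d) \<Longrightarrow> x j \<le> x i"
  shows "feasible CARD('d) k a x"
proof -
  let ?d = "CARD('d)"
  from T obtain g where eq: "spec_mat u x = frame_operator k g" and g: "\<forall>i\<in>{1..k}. (norm (g i))\<^sup>2 = a i"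
    by (auto simp: frame_operators_def)
  define m where "m j i = (cmod (cinner (u j) (g i)))\<^sup>2" for j i
  have m0: "0 \<le> m j i" for j i by (simp add: m_def)
  have xj: "x j = (\<Sum>i=1..k. m j i)" if "j < ?d" for j
  proof -
    have "x j = u j \<bullet> (spec_mat u x *v u j)"
      using that onb_norm_1[OF u, of j] by (simp add: spec_mat_eigen[OF u] dot_square_norm)
    then show ?thesis unfolding eq inner_frame_operator m_def .
  qed
  have ai: "a i = (\<Sum>j<?d. m j i)" if "i \<in> {1..k}" for i
    using g that onb_norm[OF u, of "g i"] by (simp add: m_def)
  have mle: "(\<Sum>i\<in>I. m j i) \<le> x j" if "j < ?d" "I \<subseteq> {1..k}" for I j
    unfolding xj[OF that(1)] by (rule sum_mono2[OF finite_atLeastAtMost that(2) m0])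
  have x0: "0 \<le> x j" if "j < ?d" for j
    using xj[OF that] m0[of j] sum_nonneg[of "{1..k}" "m j"] by simp
  have s1: "(\<Sum>j<?d. m j i / x j) \<le> 1" if i: "i \<in> {1..k}" for i
  proof -
    define s where "s = (\<Sum>j<?d. m j i / x j)"
    \<comment> \<open>The pseudo-inverse of the frame operator applied to \<open>g i\<close>; where \<open>x j = 0\<close>, the division by zero
      gives the coefficient 0, as it should, since then \<open>m j i = 0\<close> too.\<close>
    define y where "y = (\<Sum>j<?d. (cinner (u j) (g i) / of_real (x j)) *s u j)"
    have uy: "cinner (u j) y = cinner (u j) (g i) / of_real (x j)" if "j < ?d" for j
    proof -
      have "cinner (u j) y = (\<Sum>l<?d. if l = j then cinner (u j) (g i) / of_real (x j) else 0)"
        unfolding y_def cinner_sum_right using that u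
        by (intro sum.cong) (auto simp: cinner_simps orthonormal_def)
      then show ?thesis using that by simp
    qed
    have "cinner y (g i) = (\<Sum>j<?d. cnj (cinner (u j) (g i)) / of_real (x j) * cinner (u j) (g i))"
      unfolding y_def cinner_sum_left by (simp add: cinner_simps)
    also have "\<dots> = (\<Sum>j<?d. of_real (m j i / x j))"
    proof (intro sum.cong refl)
      fix j
      have *: "of_real (m j i) = cinner (u j) (g i) * cnj (cinner (u j) (g i))"
        by (simp only: m_def complex_norm_square)
      show "cnj (cinner (u j) (g i)) / of_real (x j) * cinner (u j) (g i) = of_real (m j i / x j)"
        unfolding of_real_divide * by (simp only: divide_inverse mult_ac)
    qed
    finally have "cinner y (g i) = of_real s" by (simp add: s_def)
    then have "s\<^sup>2 = (cmod (cinner y (g i)))\<^sup>2" by simp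
    also have "\<dots> \<le> (\<Sum>i=1..k. (cmod (cinner y (g i)))\<^sup>2)"
      using i by (intro member_le_sum) auto
    also have "\<dots> = y \<bullet> (spec_mat u x *v y)" by (simp add: eq inner_frame_operator)
    also have "\<dots> = (\<Sum>j<?d. x j * (cmod (cinner (u j) y))\<^sup>2)" by (rule inner_spec_mat)
    also have "\<dots> = s"
      unfolding s_def
      by (intro sum.cong refl) (simp add: uy m_def norm_divide power_divide power2_eq_square)
    finally have "s * s \<le> s * 1" by (simp add: power2_eq_square)
    moreover have "s < 0 \<or> s = 0 \<or> s > 0" by linarith
    ultimately have "s \<le> 1" by auto
    then show ?thesis by (simp add: s_def)
  qed
  have prefix: "top_sum k a p \<le> (\<Sum>j<p. x j)" if p: "p \<le> ?d" for p
  proof -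
    define I where "I = set (take p (ranking k a))"
    have I: "I \<subseteq> {1..k}" unfolding I_def using set_take_subset[of p "ranking k a"] by simp
    have "card I \<le> p" unfolding I_def using card_length[of "take p (ranking k a)"] by simp
    have fin: "finite I" unfolding I_def by simp
    define w where "w j = (\<Sum>i\<in>I. m j i) / x j" for j
    have "top_sum k a p = (\<Sum>i\<in>I. a i)"
      by (simp add: top_sum_def I_def sum_list_distinct_conv_sum_set)
    also have "\<dots> = (\<Sum>i\<in>I. \<Sum>j<?d. m j i)"
      using I ai by (intro sum.cong refl) blast
    also have "\<dots> = (\<Sum>j<?d. \<Sum>i\<in>I. m j i)" by (rule sum.swap)
    also have "\<dots> = (\<Sum>j<?d. w j * x j)"
    proof (rule sum.cong[OF refl])
      fix j assume "j \<in> {..<?d}"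
      then have "(\<Sum>i\<in>I. m j i) \<le> x j" using mle I by blast
      moreover have "0 \<le> (\<Sum>i\<in>I. m j i)" by (rule sum_nonneg) (rule m0)
      ultimately show "(\<Sum>i\<in>I. m j i) = w j * x j" by (cases "x j = 0") (simp_all add: w_def)
    qed
    also have "\<dots> \<le> (\<Sum>j<p. x j)"
    proof (rule weighted_sum_le_top_sum[OF dec _ _ p])
      show "0 \<le> w j" if "j < ?d" for j
        unfolding w_def by (intro divide_nonneg_nonneg sum_nonneg m0 x0 that)
      show "w j \<le> 1" if "j < ?d" for j
        using mle[OF that I] x0[OF that] by (auto simp: w_def divide_le_eq_1)
      have "(\<Sum>j<?d. w j) = (\<Sum>i\<in>I. \<Sum>j<?d. m j i / x j)"
        unfolding w_def sum_divide_distrib by (rule sum.swap)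
      also have "\<dots> \<le> (\<Sum>i\<in>I. 1)" using I s1 by (intro sum_mono) blast
      also have "\<dots> \<le> real p" using \<open>card I \<le> p\<close> by simp
      finally show "(\<Sum>j<?d. w j) = real p \<or> (\<Sum>j<?d. w j) \<le> real p \<and> (\<forall>j<?d. 0 \<le> x j)"
        using x0 by simp
    qed auto
    finally show ?thesis .
  qed
  have "(\<Sum>j<?d. x j) = (\<Sum>j<?d. \<Sum>i=1..k. m j i)" by (intro sum.cong) (auto simp: xj)
  also have "\<dots> = (\<Sum>i=1..k. \<Sum>j<?d. m j i)" by (rule sum.swap)
  also have "\<dots> = (\<Sum>i=1..k. a i)" by (intro sum.cong) (auto simp: ai)
  finally show ?thesis using prefix x0 by (simp add: feasible_def)
qed

lemma matrix_add_mult_distrib: "(A + B) ** C = A ** C + B ** (C :: complex ^ 'd ^ 'd)"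
  by (simp add: vec_eq_iff matrix_matrix_mult_def sum.distrib distrib_right)

lemma frame_operators_change_basis:
  fixes u v :: "nat \<Rightarrow> complex ^ 'd"
  assumes "onb u" "onb v" "spec_mat u x \<in> frame_operators k a"
  shows "spec_mat v x \<in> frame_operators k a"
proof -
  obtain W where W: "unitary_matrix W" "\<And>x. W ** spec_mat u x ** conj_transpose W = spec_mat v x"
    using unitary_change_basis[OF assms(1,2)] by blast
  obtain g where g: "spec_mat u x = frame_operator k g" "\<forall>i\<in>{1..k}. (norm (g i))\<^sup>2 = a i"
    using assms(3) by (auto simp: frame_operators_def)
  have distrib: "W ** (\<Sum>i\<in>I. F i) ** conj_transpose W = (\<Sum>i\<in>I. W ** F i ** conj_transpose W)"
    for I and F :: "nat \<Rightarrow> complex ^ 'd ^ 'd"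
    by (induction I rule: infinite_finite_induct)
       (simp_all add: matrix_add_ldistrib matrix_add_mult_distrib)
  have "spec_mat v x = frame_operator k (\<lambda>i. W *v g i)"
    using W(2)[of x] by (simp add: g(1) frame_operator_def distrib rank_one_image)
  then show ?thesis
    using g(2) unitary_norm[OF W(1)] unfolding frame_operators_def by auto
qed

lemma frame_operators_Suc:
  "(frame_operators (Suc k) a :: (complex ^ 'd ^ 'd) set) =
     {T + rank_one h | T h. T \<in> frame_operators k a \<and> (norm h)\<^sup>2 = a (Suc k)}" (is "?L = ?R")
proof
  show "?L \<subseteq> ?R"
    by (force simp: frame_operators_def frame_operator_def)
  show "?R \<subseteq> ?L"
  proof
    fix M assume "M \<in> ?R"
    then obtain g h where M: "M = frame_operator k g + rank_one h" "\<forall>i\<in>{1..k}. (norm (g i))\<^sup>2 = a i"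
      "(norm h)\<^sup>2 = a (Suc k)" by (auto simp: frame_operators_def)
    let ?g = "g(Suc k := h)"
    have "frame_operator (Suc k) ?g = M"
      unfolding M frame_operator_def by (auto intro!: sum.cong)
    moreover have "\<forall>i\<in>{1..Suc k}. (norm (?g i))\<^sup>2 = a i" using M by auto
    ultimately show "M \<in> ?L" unfolding frame_operators_def by blast
  qed
qed

lemma continuous_rank_one: "continuous_on A rank_one"
  unfolding rank_one_def
  by (intro continuous_intros continuous_on_vec_lambda) 

lemma compact_frame_operators: "compact (frame_operators k a :: (complex ^ 'd ^ 'd) set)"
proof (induction k)
  case 0
  have "(frame_operators 0 a :: (complex ^ 'd ^ 'd) set) = {0}"
    by (auto simp: frame_operators_def frame_operator_def)
  then show ?case by simp
next
  case (Suc k)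
  let ?H = "{h :: complex ^ 'd. (norm h)\<^sup>2 = a (Suc k)}"
  have "closed ?H" by (intro closed_Collect_eq continuous_intros)
  moreover have "bounded ?H"
    unfolding bounded_iff by (rule exI[of _ "sqrt (a (Suc k))"]) (auto intro: real_le_rsqrt)
  ultimately have "compact ?H" by (simp add: compact_eq_bounded_closed)
  then have "compact (rank_one ` ?H)"
    by (intro compact_continuous_image continuous_rank_one)
  from compact_sums[OF Suc this] show ?case
    unfolding frame_operators_Suc by (rule back_subst[of compact]) auto
qed

section \<open>Rotations in the plane of two basis vectors\<close>

lemma spec_mat_update:
  fixes u :: "nat \<Rightarrow> complex ^ 'd"
  assumes "i < CARD('d)"
  shows "spec_mat u (x(i := p)) = spec_mat u x + (p - x i) *\<^sub>R rank_one (u i)"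
proof -
  have "spec_mat u y = y i *\<^sub>R rank_one (u i) + (\<Sum>j\<in>{..<CARD('d)} - {i}. y j *\<^sub>R rank_one (u j))" for y
    unfolding spec_mat_def using assms by (intro sum.remove) auto
  from this[of x] this[of "x(i := p)"] show ?thesis
    by (simp add: scaleR_left_diff_distrib)
qed

definition rotate2 :: "(nat \<Rightarrow> complex ^ 'd) \<Rightarrow> nat \<Rightarrow> nat \<Rightarrow> real \<Rightarrow> real \<Rightarrow> nat \<Rightarrow> complex ^ 'd" where
  "rotate2 u i j c s = u(i := c *\<^sub>R u i + s *\<^sub>R u j, j := - s *\<^sub>R u i + c *\<^sub>R u j)"

lemma onb_rotate2:
  fixes u :: "nat \<Rightarrow> complex ^ 'd"
  assumes u: "onb u" and ij: "i < CARD('d)" "j < CARD('d)" "i \<noteq> j" and cs: "c\<^sup>2 + s\<^sup>2 = 1"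
  shows "onb (rotate2 u i j c s)"
proof -
  have 1: "complex_of_real c * of_real c + of_real s * of_real s = 1"
    using cs by (simp add: power2_eq_square flip: of_real_mult of_real_add)
  show ?thesis
    using u ij 1 unfolding orthonormal_def rotate2_def
    by (auto simp: cinner_simps algebra_simps)
qed

lemma spec_mat_rotate2:
  fixes u :: "nat \<Rightarrow> complex ^ 'd"
  assumes ij: "i < CARD('d)" "j < CARD('d)" "i \<noteq> j" and cs: "c\<^sup>2 + s\<^sup>2 = 1"
  shows "spec_mat (rotate2 u i j c s) x = spec_mat u x +
    (x i - x j) *\<^sub>R ((c * s) *\<^sub>R sym_outer (u i) (u j) - s\<^sup>2 *\<^sub>R (rank_one (u i) - rank_one (u j)))"
proof -
  have split: "spec_mat v x = x i *\<^sub>R rank_one (v i) + x j *\<^sub>R rank_one (v j) +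
      (\<Sum>l\<in>{..<CARD('d)} - {i, j}. x l *\<^sub>R rank_one (v l))" for v :: "nat \<Rightarrow> complex ^ 'd"
  proof -
    have "spec_mat v x = (\<Sum>l\<in>{..<CARD('d)} - {i, j}. x l *\<^sub>R rank_one (v l)) + (\<Sum>l\<in>{i, j}. x l *\<^sub>R rank_one (v l))"
      unfolding spec_mat_def using ij by (intro sum.subset_diff) auto
    then show ?thesis using ij by simp
  qed
  have c2: "c\<^sup>2 = 1 - s\<^sup>2" using cs by simp
  have "(\<Sum>l\<in>{..<CARD('d)} - {i, j}. x l *\<^sub>R rank_one (rotate2 u i j c s l)) =
      (\<Sum>l\<in>{..<CARD('d)} - {i, j}. x l *\<^sub>R rank_one (u l))"
    by (intro sum.cong) (auto simp: rotate2_def)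
  moreover have "rotate2 u i j c s i = c *\<^sub>R u i + s *\<^sub>R u j" "rotate2 u i j c s j = (- s) *\<^sub>R u i + c *\<^sub>R u j"
    using ij by (simp_all add: rotate2_def)
  ultimately show ?thesis
    unfolding split[of u] split[of "rotate2 u i j c s"]
    by (simp only: rank_one_comb c2) (simp add: algebra_simps)
qed

text \<open>
Parametrizing rotations by \<open>c s\<close> makes the first-order term of the rotated matrices in
\<open>spec_mat_rotate2\<close> and of the rotated frame vectors exactly linear in the parameter.
\<close>

lemma small_rotation:
  fixes \<tau> :: real
  assumes "\<bar>\<tau>\<bar> \<le> 1 / 2"
  obtains c s where "c\<^sup>2 + s\<^sup>2 = 1" "c * s = \<tau>" "s\<^sup>2 \<le> 2 * \<tau>\<^sup>2"
proof -
  have "\<tau>\<^sup>2 \<le> (1 / 2)\<^sup>2" using assms by (metis abs_ge_zero power2_abs power_mono)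
  then have t: "0 \<le> 1 - 4 * \<tau>\<^sup>2" by (simp add: power2_eq_square)
  define q where "q = sqrt (1 - 4 * \<tau>\<^sup>2)"
  have q: "0 \<le> q" "q \<le> 1" "q\<^sup>2 = 1 - 4 * \<tau>\<^sup>2" using t by (simp_all add: q_def)
  define c where "c = sqrt ((1 + q) / 2)"
  define s where "s = \<tau> / c"
  have c2: "c\<^sup>2 = (1 + q) / 2" and c0: "c > 0" using q(1) by (simp_all add: c_def)
  have "\<tau>\<^sup>2 = c\<^sup>2 * ((1 - q) / 2)"
    using q(3) unfolding c2 by (simp add: power2_eq_square algebra_simps)
  then have s2: "s\<^sup>2 = (1 - q) / 2"
    using c0 unfolding s_def by (simp add: power_divide)
  have "4 * \<tau>\<^sup>2 = (1 - q) * (1 + q)" using q(3) by (simp add: power2_eq_square algebra_simps)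
  moreover have "(1 - q) * 1 \<le> (1 - q) * (1 + q)" using q by (intro mult_left_mono) auto
  ultimately have "s\<^sup>2 \<le> 2 * \<tau>\<^sup>2" using s2 by linarith
  moreover have "c\<^sup>2 + s\<^sup>2 = 1" by (simp add: c2 s2 field_simps)
  moreover have "c * s = \<tau>" using c0 by (simp add: s_def)
  ultimately show ?thesis using that by blast
qed

text \<open>
The rotation that diagonalizes the symmetric 2 by 2 matrix with rows \<open>(X, Y)\<close> and \<open>(Y, - X)\<close>, whose
eigenvalues are \<open>\<rho>\<close> and \<open>- \<rho>\<close>.
\<close>

lemma half_angle:
  fixes X Y :: real
  obtains \<rho> c s where "c\<^sup>2 + s\<^sup>2 = 1" "\<rho> * (1 - 2 * s\<^sup>2) = X" "2 * \<rho> * (c * s) = Y" "\<rho>\<^sup>2 = X\<^sup>2 + Y\<^sup>2"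
proof -
  obtain r \<theta> where r: "X = r * cos \<theta>" "Y = r * sin \<theta>" using polar_Ex by blast
  have 1: "cos \<theta> = 1 - 2 * (sin (\<theta> / 2))\<^sup>2" "sin \<theta> = 2 * sin (\<theta> / 2) * cos (\<theta> / 2)"
    using cos_double_sin[of "\<theta> / 2"] sin_double[of "\<theta> / 2"] by simp_all
  have "X\<^sup>2 + Y\<^sup>2 = r\<^sup>2 * ((cos \<theta>)\<^sup>2 + (sin \<theta>)\<^sup>2)"
    unfolding r by (simp only: power_mult_distrib distrib_left)
  then have "r\<^sup>2 = X\<^sup>2 + Y\<^sup>2" by simp
  moreover have "2 * r * (cos (\<theta> / 2) * sin (\<theta> / 2)) = Y" unfolding r 1 by simp
  moreover have "r * (1 - 2 * (sin (\<theta> / 2))\<^sup>2) = X" using r(1) 1(1) by simp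
  ultimately show ?thesis using that[of "cos (\<theta> / 2)" "sin (\<theta> / 2)" r] by simp
qed

lemma orthonormal_pair_card:
  fixes u :: "nat \<Rightarrow> complex ^ 'd"
  assumes "orthonormal 2 u"
  shows "2 \<le> CARD('d)"
proof (rule ccontr)
  assume "\<not> 2 \<le> CARD('d)"
  moreover have "0 < CARD('d)" by simp
  ultimately have card: "CARD('d) = 1" by linarith
  then have "onb u" using assms by (auto simp: orthonormal_def)
  from onb_expansion[OF this, of "u 1"] have "u 1 = 0"
    using assms by (simp add: card orthonormal_def)
  moreover have "cinner (u 1) (u 1) = 1" using assms by (simp add: orthonormal_def)
  ultimately show False by simp
qed

lemma eigenbasis_through_pair:
  fixes R :: "complex ^ 'd ^ 'd"
  assumes herm: "conj_transpose R = R" and e: "norm e = 1" "R *v e = r *\<^sub>R e"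
    and f: "norm f = 1" "R *v f = s *\<^sub>R f" and ne: "r \<noteq> s"
  obtains v \<sigma> where "onb v" "R = spec_mat v \<sigma>" "v 0 = e" "v 1 = f" "\<sigma> 0 = r" "\<sigma> 1 = s" "2 \<le> CARD('d)"
proof -
  let ?u = "\<lambda>i :: nat. if i = 0 then e else f" and ?\<alpha> = "\<lambda>i :: nat. if i = 0 then r else s"
  have "of_real r * cinner e f = of_real s * cinner e f"
    using cinner_hermitian[OF herm, of e f] e f by (simp add: cinner_simps)
  then have "cinner e f = 0" "cinner f e = 0" using ne cinner_commute[of f e] by auto
  then have on: "orthonormal 2 ?u"
    using e f by (auto simp: orthonormal_def cinner_self)
  have eig: "\<forall>i<2. R *v ?u i = ?\<alpha> i *\<^sub>R ?u i" using e f by simp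
  obtain v \<sigma> \<tau> where "onb v" "\<forall>i<2. v i = ?u i \<and> \<sigma> i = ?\<alpha> i \<and> \<tau> i = ?\<alpha> i" "R = spec_mat v \<sigma>"
    by (rule extend_eigenbasis[OF herm herm refl on orthonormal_pair_card[OF on] eig eig]) blast
  then show ?thesis using that[of v \<sigma>] orthonormal_pair_card[OF on] by auto
qed

section \<open>Strictly convex unitarily invariant norms\<close>

context
  fixes N :: "complex ^ 'd ^ 'd \<Rightarrow> real"
  assumes N: "strictly_convex_ui_norm N"
begin

lemma ui_norm_triangle: "N (A + B) \<le> N A + N B"
  using N by (simp add: strictly_convex_ui_norm_def matrix_norm_def)

lemma ui_norm_nonneg: "0 \<le> N A"
  using N by (simp add: strictly_convex_ui_norm_def matrix_norm_def)

lemma ui_norm_eq_0: "N A = 0 \<longleftrightarrow> A = 0"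
  using N by (simp add: strictly_convex_ui_norm_def matrix_norm_def)

lemma ui_norm_zero: "N 0 = 0"
  by (simp add: ui_norm_eq_0)

lemma ui_norm_scale: "N (\<chi> i j. c * A $ i $ j) = cmod c * N A"
  using N unfolding strictly_convex_ui_norm_def matrix_norm_def by blast

lemma ui_norm_scaleR: "N (r *\<^sub>R A) = \<bar>r\<bar> * N A"
proof -
  have "r *\<^sub>R A = (\<chi> i j. of_real r * A $ i $ j)"
    by (simp add: vec_eq_iff) (simp add: scaleR_conv_of_real)
  then show ?thesis using ui_norm_scale[of "of_real r" A] by simp
qed

lemma ui_norm_minus: "N (A - B) \<le> N A + N B"
  using ui_norm_triangle[of A "(-1) *\<^sub>R B"] ui_norm_scaleR[of "-1" B] by simp

lemma ui_norm_sum: "N (\<Sum>i\<in>I. F i) \<le> (\<Sum>i\<in>I. N (F i))"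
proof (induction I rule: infinite_finite_induct)
  case (insert i I)
  then show ?case using ui_norm_triangle[of "F i" "\<Sum>i\<in>I. F i"] by simp
qed (simp_all add: ui_norm_zero)

lemma ui_norm_le_euclidean: obtains K where "0 < K" "\<And>A. N A \<le> K * norm A"
proof -
  define E :: "'d \<Rightarrow> 'd \<Rightarrow> complex ^ 'd ^ 'd" where "E p q = (\<chi> i j. if i = p \<and> j = q then 1 else 0)" for p q
  define K where "K = (\<Sum>p\<in>UNIV. \<Sum>q\<in>UNIV. N (E p q)) + 1"
  have "N A \<le> K * norm A" for A
  proof -
    have "A = (\<Sum>p\<in>UNIV. \<Sum>q\<in>UNIV. (\<chi> i j. A $ p $ q * E p q $ i $ j))"
    proof -
      have "(\<Sum>p\<in>UNIV. \<Sum>q\<in>UNIV. A $ p $ q * E p q $ i $ j) = A $ i $ j" for i j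
      proof -
        have "(\<Sum>p\<in>UNIV. \<Sum>q\<in>UNIV. A $ p $ q * E p q $ i $ j) =
            (\<Sum>p\<in>UNIV. \<Sum>q\<in>UNIV. if p = i then (if q = j then A $ p $ q else 0) else 0)"
          by (intro sum.cong refl) (auto simp: E_def)
        also have "\<dots> = (\<Sum>p\<in>UNIV. if p = i then (\<Sum>q\<in>UNIV. if q = j then A $ p $ q else 0) else 0)"
          by (intro sum.cong refl) simp
        finally have "(\<Sum>p\<in>UNIV. \<Sum>q\<in>UNIV. A $ p $ q * E p q $ i $ j) =
            (\<Sum>p\<in>UNIV. if p = i then (\<Sum>q\<in>UNIV. if q = j then A $ p $ q else 0) else 0)" .
        then show ?thesis by simp
      qed
      then show ?thesis by (simp add: vec_eq_iff)
    qed
    then have "N A = N (\<Sum>p\<in>UNIV. \<Sum>q\<in>UNIV. (\<chi> i j. A $ p $ q * E p q $ i $ j))"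
      by (rule arg_cong)
    also have "\<dots> \<le> (\<Sum>p\<in>UNIV. N (\<Sum>q\<in>UNIV. (\<chi> i j. A $ p $ q * E p q $ i $ j)))"
      by (rule ui_norm_sum)
    also have "\<dots> \<le> (\<Sum>p\<in>UNIV. \<Sum>q\<in>UNIV. N (\<chi> i j. A $ p $ q * E p q $ i $ j))"
      by (intro sum_mono ui_norm_sum)
    also have "\<dots> \<le> (\<Sum>p\<in>UNIV. \<Sum>q\<in>UNIV. norm A * N (E p q))"
    proof (intro sum_mono)
      fix p q
      have "cmod (A $ p $ q) \<le> norm A"
        using Finite_Cartesian_Product.norm_nth_le[of "A $ p" q]
          Finite_Cartesian_Product.norm_nth_le[of A p] by linarith
      then show "N (\<chi> i j. A $ p $ q * E p q $ i $ j) \<le> norm A * N (E p q)"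
        unfolding ui_norm_scale by (intro mult_right_mono ui_norm_nonneg)
    qed
    also have "\<dots> \<le> K * norm A"
      by (simp add: K_def sum_distrib_left[symmetric] algebra_simps)
    finally show ?thesis .
  qed
  moreover have "0 < K"
    unfolding K_def by (intro add_nonneg_pos sum_nonneg ui_norm_nonneg) simp
  ultimately show ?thesis using that by blast
qed

lemma ui_norm_continuous: "continuous_on X N"
proof -
  obtain K where K: "0 < K" "\<And>A. N A \<le> K * norm A" by (rule ui_norm_le_euclidean) blast
  have "dist (N A) (N B) \<le> K * dist A B" for A B
  proof -
    have "N A \<le> N B + N (A - B)" using ui_norm_triangle[of B "A - B"] by simp
    moreover have "N B \<le> N A + N (B - A)" using ui_norm_triangle[of A "B - A"] by simp
    ultimately show ?thesis
      using K(2)[of "A - B"] K(2)[of "B - A"] by (auto simp: dist_norm norm_minus_commute)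
  qed
  then have "K-lipschitz_on X N" using K(1) by (intro lipschitz_onI) auto
  then show ?thesis by (rule lipschitz_on_continuous_on)
qed

lemma ui_norm_spec_mat_diag:
  fixes u :: "nat \<Rightarrow> complex ^ 'd"
  assumes "onb u"
  shows "N (spec_mat u x) = N (diag_matrix (\<chi> i. of_real (x (index_of i))))"
proof -
  have "unitary_matrix (basis_mat u)" "unitary_matrix (conj_transpose (basis_mat u))"
    using unitary_basis_mat[OF assms] by (simp_all add: unitary_matrix_def)
  then show ?thesis
    using N unfolding spec_mat_eq_diag strictly_convex_ui_norm_def unitarily_invariant_def by blast
qed

lemma ui_norm_spec_mat_basis:
  fixes u v :: "nat \<Rightarrow> complex ^ 'd"
  assumes "onb u" "onb v"
  shows "N (spec_mat u x) = N (spec_mat v x)"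
  using assms by (simp add: ui_norm_spec_mat_diag)

text \<open>
In the basis \<open>u\<close> this is strict convexity on diagonal matrices; the unit sphere of that definition is
reached by dividing by the common norm, which is not zero because the two spectra differ.
\<close>

lemma ui_norm_spec_mat_strict:
  fixes u :: "nat \<Rightarrow> complex ^ 'd"
  assumes u: "onb u" and eq: "N (spec_mat u x) = N (spec_mat u y)"
    and ne: "i < CARD('d)" "x i \<noteq> y i" and t: "0 < t" "t < 1"
  shows "N (spec_mat u (\<lambda>j. (1 - t) * x j + t * y j)) < N (spec_mat u x)"
proof -
  define D where "D z = (\<chi> i :: 'd. complex_of_real (z (index_of i)))" for z
  define n where "n = N (spec_mat u x)"
  have nD: "N (spec_mat u z) = N (diag_matrix (D z))" for z
    using ui_norm_spec_mat_diag[OF u] by (simp add: D_def)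
  have diag_scale: "diag_matrix (r *\<^sub>R z) = r *\<^sub>R diag_matrix z" for r and z :: "complex ^ 'd"
    by (simp add: vec_eq_iff diag_matrix_def)
  obtain p :: 'd where p: "index_of p = i"
    using bij_index_of[where 'd='d] ne(1) unfolding bij_betw_def by (auto elim!: equalityE dest!: subsetD)
  have Dne: "D x \<noteq> D y"
    using ne(2) p by (auto simp: D_def vec_eq_iff)
  have "n \<noteq> 0"
  proof
    assume "n = 0"
    then have "N (diag_matrix (D x)) = 0" "N (diag_matrix (D y)) = 0"
      using eq by (simp_all only: n_def nD)
    then have "diag_matrix (D x) = 0" "diag_matrix (D y) = 0"
      by (simp_all only: ui_norm_eq_0)
    then have "diag_matrix (D x) $ p $ p = diag_matrix (D y) $ p $ p" by simp
    then show False using ne(2) p by (simp add: diag_matrix_def D_def)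
  qed
  then have n: "n > 0" using ui_norm_nonneg by (simp add: n_def less_le)
  have "strictly_convex_norm (\<lambda>x. N (diag_matrix x))"
    using N by (simp add: strictly_convex_ui_norm_def)
  moreover have "N (diag_matrix (D x)) = n" "N (diag_matrix (D y)) = n"
    using eq by (simp_all only: n_def nD)
  then have "N (diag_matrix (D x /\<^sub>R n)) = 1" "N (diag_matrix (D y /\<^sub>R n)) = 1"
    using n by (simp_all add: diag_scale ui_norm_scaleR)
  moreover have "D x /\<^sub>R n \<noteq> D y /\<^sub>R n" using Dne n by simp
  ultimately have "N (diag_matrix ((1 - t) *\<^sub>R (D x /\<^sub>R n) + t *\<^sub>R (D y /\<^sub>R n))) < 1"
    using t unfolding strictly_convex_norm_def by blast
  moreover have "(1 - t) *\<^sub>R (D x /\<^sub>R n) + t *\<^sub>R (D y /\<^sub>R n) = D (\<lambda>j. (1 - t) * x j + t * y j) /\<^sub>R n"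
    by (simp add: vec_eq_iff D_def) (simp add: scaleR_conv_of_real algebra_simps)
  ultimately have "N (diag_matrix (D (\<lambda>j. (1 - t) * x j + t * y j))) / n < 1"
    using n by (simp add: diag_scale ui_norm_scaleR divide_inverse mult.commute)
  then have "N (diag_matrix (D (\<lambda>j. (1 - t) * x j + t * y j))) < n" using n by simp
  then show ?thesis by (simp only: nD n_def)
qed

text \<open>
The new spectrum is a proper convex combination of the old one and the one with entries \<open>i\<close> and \<open>j\<close>
exchanged, which is the old one in a basis rotated by a right angle and so has the same norm.
\<close>

lemma ui_norm_average_less:
  fixes u :: "nat \<Rightarrow> complex ^ 'd"
  assumes u: "onb u" and ij: "i < CARD('d)" "j < CARD('d)" "x j < x i" and \<delta>: "0 < \<delta>" "\<delta> < x i - x j"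
  shows "N (spec_mat u (x(i := x i - \<delta>, j := x j + \<delta>))) < N (spec_mat u x)"
proof -
  have "i \<noteq> j" using ij by auto
  define y where "y = x(i := x j, j := x i)"
  define t where "t = \<delta> / (x i - x j)"
  have "spec_mat (rotate2 u i j 0 1) x = spec_mat u y"
    using ij \<open>i \<noteq> j\<close> by (simp add: spec_mat_rotate2 y_def spec_mat_update algebra_simps)
  moreover have "onb (rotate2 u i j 0 1)" by (rule onb_rotate2[OF u ij(1,2) \<open>i \<noteq> j\<close>]) simp
  ultimately have "N (spec_mat u x) = N (spec_mat u y)"
    using ui_norm_spec_mat_basis[OF u] by metis
  moreover have "x i \<noteq> y i" using ij \<open>i \<noteq> j\<close> by (simp add: y_def)
  moreover have "0 < t" "t < 1" using \<delta> by (simp_all add: t_def)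
  ultimately have "N (spec_mat u (\<lambda>l. (1 - t) * x l + t * y l)) < N (spec_mat u x)"
    using ui_norm_spec_mat_strict[OF u _ ij(1)] by blast
  moreover have "(\<lambda>l. (1 - t) * x l + t * y l) = x(i := x i - \<delta>, j := x j + \<delta>)"
  proof -
    have "t * (x i - x j) = \<delta>" using ij by (simp add: t_def)
    then show ?thesis using \<open>i \<noteq> j\<close> by (auto simp: fun_eq_iff y_def algebra_simps)
  qed
  ultimately show ?thesis by simp
qed

end

section \<open>Frame vectors of a local minimizer are eigenvectors of the difference\<close>

text \<open>
An upper bound for the one-sided directional derivative of \<open>N\<close> at \<open>R\<close> in the direction \<open>D\<close>.
Unitarily invariant norms need not be differentiable, but convexity makes such bounds subadditive in
\<open>D\<close>, and this is all that the first-order argument needs.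
\<close>

definition slope_le :: "(complex ^ 'd ^ 'd \<Rightarrow> real) \<Rightarrow> complex ^ 'd ^ 'd \<Rightarrow> complex ^ 'd ^ 'd \<Rightarrow> real \<Rightarrow> bool" where
  "slope_le N R D \<eta> \<longleftrightarrow> (\<forall>\<^sub>F t in at_right 0. N (R + t *\<^sub>R D) \<le> N R + \<eta> * t)"

definition slope_nonpos :: "(complex ^ 'd ^ 'd \<Rightarrow> real) \<Rightarrow> complex ^ 'd ^ 'd \<Rightarrow> complex ^ 'd ^ 'd \<Rightarrow> bool" where
  "slope_nonpos N R D \<longleftrightarrow> (\<forall>\<epsilon>>0. slope_le N R D \<epsilon>)"

lemma eventually_at_right_linear_less:
  fixes A C :: real
  assumes "0 < \<epsilon>"
  shows "\<forall>\<^sub>F t in at_right 0. A * t + C * t\<^sup>2 < \<epsilon>"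
proof -
  have "((\<lambda>t. A * t + C * t\<^sup>2) \<longlongrightarrow> A * 0 + C * 0\<^sup>2) (at_right 0)"
    by (intro tendsto_intros)
  then show ?thesis using assms by (intro order_tendstoD) auto
qed

context
  fixes N :: "complex ^ 'd ^ 'd \<Rightarrow> real"
  assumes N: "strictly_convex_ui_norm N"
begin

text \<open>
The point \<open>R + t (D + D')\<close> is the midpoint of \<open>R + 2 t D\<close> and \<open>R + 2 t D'\<close>.
\<close>

lemma slope_le_add:
  assumes "slope_le N R D \<eta>" "slope_le N R D' \<eta>'"
  shows "slope_le N R (D + D') (\<eta> + \<eta>')"
proof -
  obtain b where b: "b > 0" "\<And>t. 0 < t \<Longrightarrow> t < b \<Longrightarrow> N (R + t *\<^sub>R D) \<le> N R + \<eta> * t"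
    using assms(1) unfolding slope_le_def eventually_at_right_field by auto
  obtain b' where b': "b' > 0" "\<And>t. 0 < t \<Longrightarrow> t < b' \<Longrightarrow> N (R + t *\<^sub>R D') \<le> N R + \<eta>' * t"
    using assms(2) unfolding slope_le_def eventually_at_right_field by auto
  have "N (R + t *\<^sub>R (D + D')) \<le> N R + (\<eta> + \<eta>') * t" if t: "0 < t" "t < min b b' / 2" for t
  proof -
    have "R + t *\<^sub>R (D + D') = (1 / 2) *\<^sub>R (R + (2 * t) *\<^sub>R D) + (1 / 2) *\<^sub>R (R + (2 * t) *\<^sub>R D')"
      by (simp add: scaleR_add_right scaleR_half_double flip: scaleR_add_left)
    also have "N \<dots> \<le> (1 / 2) * N (R + (2 * t) *\<^sub>R D) + (1 / 2) * N (R + (2 * t) *\<^sub>R D')"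
      using ui_norm_triangle[OF N, of "(1 / 2) *\<^sub>R (R + (2 * t) *\<^sub>R D)" "(1 / 2) *\<^sub>R (R + (2 * t) *\<^sub>R D')"]
      by (simp add: ui_norm_scaleR[OF N])
    also have "\<dots> \<le> (1 / 2) * (N R + \<eta> * (2 * t)) + (1 / 2) * (N R + \<eta>' * (2 * t))"
      using t by (intro add_mono mult_left_mono b(2) b'(2)) auto
    also have "\<dots> = N R + (\<eta> + \<eta>') * t" by (simp add: algebra_simps)
    finally show ?thesis .
  qed
  then show ?thesis
    unfolding slope_le_def eventually_at_right_field using b(1) b'(1)
    by (intro exI[of _ "min b b' / 2"]) auto
qed

lemma slope_le_of_descent:
  assumes "0 < \<delta>" "N (R + \<delta> *\<^sub>R D) < N R"
  obtains \<eta> where "0 < \<eta>" "slope_le N R D (- \<eta>)"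
proof -
  define \<eta> where "\<eta> = (N R - N (R + \<delta> *\<^sub>R D)) / \<delta>"
  have "N (R + t *\<^sub>R D) \<le> N R + - \<eta> * t" if t: "0 < t" "t < \<delta>" for t
  proof -
    define q where "q = t / \<delta>"
    have q: "0 \<le> q" "q \<le> 1" "t = q * \<delta>" using t by (simp_all add: q_def)
    have "R + t *\<^sub>R D = (1 - q) *\<^sub>R R + q *\<^sub>R (R + \<delta> *\<^sub>R D)"
      by (simp add: q(3) algebra_simps)
    also have "N \<dots> \<le> (1 - q) * N R + q * N (R + \<delta> *\<^sub>R D)"
      using ui_norm_triangle[OF N, of "(1 - q) *\<^sub>R R" "q *\<^sub>R (R + \<delta> *\<^sub>R D)"] q(1,2)
      by (simp add: ui_norm_scaleR[OF N])
    also have "\<dots> = N R + - \<eta> * t"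
      using assms(1) by (simp add: q(3) \<eta>_def field_simps)
    finally show ?thesis .
  qed
  then have "slope_le N R D (- \<eta>)"
    unfolding slope_le_def eventually_at_right_field using assms(1) by (intro exI[of _ \<delta>]) auto
  moreover have "0 < \<eta>" using assms by (simp add: \<eta>_def)
  ultimately show ?thesis using that by blast
qed

lemma slope_nonpos_add: "slope_nonpos N R D \<Longrightarrow> slope_nonpos N R D' \<Longrightarrow> slope_nonpos N R (D + D')"
  unfolding slope_nonpos_def by (metis slope_le_add field_sum_of_halves half_gt_zero)

lemma slope_nonpos_zero: "slope_nonpos N R 0"
  unfolding slope_nonpos_def slope_le_def
  by (auto simp: eventually_at_right_field intro!: exI[of _ 1])

lemma slope_nonpos_sum: "(\<And>i. i \<in> I \<Longrightarrow> slope_nonpos N R (F i)) \<Longrightarrow> slope_nonpos N R (\<Sum>i\<in>I. F i)"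
  by (induction I rule: infinite_finite_induct) (auto simp: slope_nonpos_zero intro: slope_nonpos_add)

lemma slope_nonpos_quadratic:
  assumes "\<forall>\<^sub>F t in at_right 0. N (R + t *\<^sub>R D) \<le> N R + C * t\<^sup>2"
  shows "slope_nonpos N R D"
  unfolding slope_nonpos_def slope_le_def
proof (intro allI impI)
  fix \<epsilon> :: real assume "0 < \<epsilon>"
  from eventually_at_right_linear_less[OF this, of C 0] assms eventually_at_right_less[of 0]
  show "\<forall>\<^sub>F t in at_right 0. N (R + t *\<^sub>R D) \<le> N R + \<epsilon> * t"
  proof eventually_elim
    case (elim t)
    then have "C * t\<^sup>2 \<le> \<epsilon> * t" by (simp add: power2_eq_square mult_right_mono flip: mult.assoc)
    then show ?case using elim by linarith
  qed
qed

text \<open>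
Rotating in the plane of two orthogonal eigenvectors moves \<open>R\<close> along its unitary orbit, where \<open>N\<close> is
constant.  If the eigenvalues differ, the tangent of this curve is a multiple of the symmetrized outer
product, and the deviation of the curve from its tangent is quadratic.
\<close>

lemma slope_nonpos_sym_outer:
  assumes herm: "conj_transpose R = R" and x: "R *v x = r *\<^sub>R x" and y: "R *v y = s *\<^sub>R y" and ne: "r \<noteq> s"
  shows "slope_nonpos N R (sym_outer x y)"
proof (cases "x = 0 \<or> y = 0")
  case True
  then show ?thesis by (auto simp: slope_nonpos_zero)
next
  case False
  define e where "e = x /\<^sub>R norm x"
  define f where "f = y /\<^sub>R norm y"
  define \<kappa> where "\<kappa> = norm x * norm y"
  have e: "norm e = 1" "R *v e = r *\<^sub>R e" and f: "norm f = 1" "R *v f = s *\<^sub>R f"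
    using False x y by (simp_all add: e_def f_def matrix_vector_mult_scaleR)
  have "x = norm x *\<^sub>R e" "y = norm y *\<^sub>R f" using False by (simp_all add: e_def f_def)
  then have "sym_outer x y = sym_outer (norm x *\<^sub>R e) (norm y *\<^sub>R f)" by simp
  then have sym: "sym_outer x y = \<kappa> *\<^sub>R sym_outer e f"
    by (simp add: \<kappa>_def sym_outer_scaleR sym_outer_scaleR_right mult.commute)
  have \<kappa>: "\<kappa> > 0" using False by (simp add: \<kappa>_def)
  obtain v \<sigma> where v: "onb v" "R = spec_mat v \<sigma>" "v 0 = e" "v 1 = f" "\<sigma> 0 = r" "\<sigma> 1 = s" and d: "2 \<le> CARD('d)"
    by (rule eigenbasis_through_pair[OF herm e f ne]) blast
  define \<rho> where "\<rho> = \<kappa> / (r - s)"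
  define G where "G = rank_one e - rank_one f"
  show ?thesis
  proof (rule slope_nonpos_quadratic)
    have "\<forall>\<^sub>F t in at_right 0. \<bar>\<rho>\<bar> * t + 0 * t\<^sup>2 < 1 / 2"
      by (rule eventually_at_right_linear_less) simp
    then show "\<forall>\<^sub>F t in at_right 0. N (R + t *\<^sub>R sym_outer x y) \<le> N R + (\<bar>r - s\<bar> * (2 * \<rho>\<^sup>2) * N G) * t\<^sup>2"
      using eventually_at_right_less[of 0]
    proof eventually_elim
      case (elim t)
      then have "\<bar>\<rho> * t\<bar> \<le> 1 / 2" by (simp add: abs_mult)
      then obtain c q where cq: "c\<^sup>2 + q\<^sup>2 = 1" "c * q = \<rho> * t" "q\<^sup>2 \<le> 2 * (\<rho> * t)\<^sup>2"
        by (rule small_rotation)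
      have "N R = N (spec_mat (rotate2 v 0 1 c q) \<sigma>)"
        unfolding v(2) using d by (intro ui_norm_spec_mat_basis[OF N v(1)] onb_rotate2[OF v(1)] cq(1)) auto
      also have "spec_mat (rotate2 v 0 1 c q) \<sigma> = R + (r - s) *\<^sub>R ((\<rho> * t) *\<^sub>R sym_outer e f - q\<^sup>2 *\<^sub>R G)"
        using d by (subst spec_mat_rotate2) (simp_all add: cq v(3-6) v(2)[symmetric] G_def del: One_nat_def)
      also have "\<dots> = R + t *\<^sub>R sym_outer x y - ((r - s) * q\<^sup>2) *\<^sub>R G"
      proof -
        have "(r - s) * (\<rho> * t) = t * \<kappa>" using ne by (simp add: \<rho>_def)
        then show ?thesis unfolding sym by (simp add: scaleR_diff_right)
      qed
      finally have "N R = N (R + t *\<^sub>R sym_outer x y - ((r - s) * q\<^sup>2) *\<^sub>R G)" .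
      moreover have "N (R + t *\<^sub>R sym_outer x y) \<le>
          N (R + t *\<^sub>R sym_outer x y - ((r - s) * q\<^sup>2) *\<^sub>R G) + N (((r - s) * q\<^sup>2) *\<^sub>R G)"
        using ui_norm_triangle[OF N, of "R + t *\<^sub>R sym_outer x y - ((r - s) * q\<^sup>2) *\<^sub>R G" "((r - s) * q\<^sup>2) *\<^sub>R G"]
        by simp
      moreover have "N (((r - s) * q\<^sup>2) *\<^sub>R G) \<le> (\<bar>r - s\<bar> * (2 * \<rho>\<^sup>2) * N G) * t\<^sup>2"
      proof -
        have "\<bar>r - s\<bar> * q\<^sup>2 * N G \<le> \<bar>r - s\<bar> * (2 * (\<rho> * t)\<^sup>2) * N G"
          by (intro mult_left_mono mult_right_mono cq(3) ui_norm_nonneg[OF N]) auto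
        then show ?thesis
          by (simp add: ui_norm_scaleR[OF N] abs_mult power_mult_distrib mult_ac)
      qed
      ultimately show ?case by linarith
    qed
  qed
qed

lemma slope_average:
  assumes herm: "conj_transpose R = R" and e: "norm e = 1" "R *v e = r *\<^sub>R e"
    and f: "norm f = 1" "R *v f = s *\<^sub>R f" and less: "s < r"
  obtains \<eta> where "0 < \<eta>" "slope_le N R (2 *\<^sub>R rank_one f - 2 *\<^sub>R rank_one e) (- \<eta>)"
proof -
  obtain v \<sigma> where v: "onb v" "R = spec_mat v \<sigma>" "v 0 = e" "v 1 = f" "\<sigma> 0 = r" "\<sigma> 1 = s" and d: "2 \<le> CARD('d)"
    by (rule eigenbasis_through_pair[OF herm e f]) (use less in blast)+
  define \<delta> where "\<delta> = (r - s) / 2"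
  have "N (spec_mat v (\<sigma>(0 := \<sigma> 0 - \<delta>, 1 := \<sigma> 1 + \<delta>))) < N (spec_mat v \<sigma>)"
    using d less by (intro ui_norm_average_less[OF N v(1)]) (auto simp: v \<delta>_def simp del: One_nat_def)
  moreover have "spec_mat v (\<sigma>(0 := \<sigma> 0 - \<delta>, 1 := \<sigma> 1 + \<delta>)) =
      R + (\<delta> / 2) *\<^sub>R (2 *\<^sub>R rank_one f - 2 *\<^sub>R rank_one e)"
    using d by (simp add: spec_mat_update v(3,4) v(2)[symmetric] scaleR_diff_right del: One_nat_def)
  ultimately have "N (R + (\<delta> / 2) *\<^sub>R (2 *\<^sub>R rank_one f - 2 *\<^sub>R rank_one e)) < N R"
    using v(2) by simp
  moreover have "0 < \<delta> / 2" using less by (simp add: \<delta>_def)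
  ultimately show ?thesis using slope_le_of_descent that by blast
qed

lemma local_minimizer_near:
  assumes "local_minimizer (Psi N S) X T"
  obtains \<epsilon> where "0 < \<epsilon>" "\<And>T'. T' \<in> X \<Longrightarrow> norm (T' - T) < \<epsilon> \<Longrightarrow> N (S - T) \<le> N (S - T')"
proof -
  obtain W where W: "open W" "T \<in> W" "\<forall>y\<in>X \<inter> W. Psi N S T \<le> Psi N S y"
    using assms by (auto simp: local_minimizer_def)
  obtain \<epsilon> where "0 < \<epsilon>" "\<forall>T'. dist T' T < \<epsilon> \<longrightarrow> T' \<in> W"
    using W(1,2) by (auto simp: open_dist)
  then show ?thesis using that[of \<epsilon>] W(3) by (auto simp: Psi_def dist_norm)
qed

text \<open>
The feasible set is curved, so a direction is followed only up to a quadratic error, which the linear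
decrease outweighs.
\<close>

lemma local_minimizer_no_descent:
  assumes min: "local_minimizer (Psi N S) X T"
    and curve: "\<forall>\<^sub>F t in at_right 0. \<exists>E. norm E \<le> C * t\<^sup>2 \<and> T - t *\<^sub>R D + E \<in> X"
    and slope: "slope_le N (S - T) D (- \<eta>)" and \<eta>: "0 < \<eta>"
  shows False
proof -
  obtain \<epsilon> where \<epsilon>: "0 < \<epsilon>" "\<And>T'. T' \<in> X \<Longrightarrow> norm (T' - T) < \<epsilon> \<Longrightarrow> N (S - T) \<le> N (S - T')"
    by (rule local_minimizer_near[OF min]) blast
  obtain K where K: "0 < K" "\<And>A. N A \<le> K * norm A" by (rule ui_norm_le_euclidean[OF N]) blast
  have "\<forall>\<^sub>F t in at_right (0 :: real). False"
    using curve slope[unfolded slope_le_def] eventually_at_right_less[of 0]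
      eventually_at_right_linear_less[OF \<epsilon>(1), of "norm D" C] eventually_at_right_linear_less[OF \<eta>, of "K * C" 0]
  proof eventually_elim
    case (elim t)
    then obtain E where E: "norm E \<le> C * t\<^sup>2" "T - t *\<^sub>R D + E \<in> X" by blast
    have "norm (T - t *\<^sub>R D + E - T) \<le> norm (t *\<^sub>R D) + norm E"
      using norm_triangle_ineq4[of E "t *\<^sub>R D"] by (simp add: algebra_simps)
    also have "\<dots> < \<epsilon>" using E(1) elim by (simp add: algebra_simps)
    finally have "N (S - T) \<le> N (S - (T - t *\<^sub>R D + E))" by (rule \<epsilon>(2)[OF E(2)])
    also have "S - (T - t *\<^sub>R D + E) = (S - T + t *\<^sub>R D) - E" by simp
    also have "N \<dots> \<le> N (S - T + t *\<^sub>R D) + N E" by (rule ui_norm_minus[OF N])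
    also have "\<dots> \<le> N (S - T) + - \<eta> * t + K * C * t\<^sup>2"
    proof -
      have "N E \<le> K * (C * t\<^sup>2)"
        using K(2)[of E] mult_left_mono[OF E(1), of K] K(1) by linarith
      then show ?thesis using elim by (simp add: mult.assoc)
    qed
    also have "\<dots> < N (S - T)"
    proof -
      have "(K * C * t) * t < \<eta> * t" using elim by (intro mult_strict_right_mono) auto
      then show ?thesis by (simp add: power2_eq_square algebra_simps)
    qed
    finally show False by simp
  qed
  then show False by simp
qed

text \<open>
Let \<open>h\<close> be a frame vector with components \<open>P (\<sigma> p)\<close> and \<open>P (\<sigma> q)\<close> in eigenspaces of \<open>R\<close> for
\<open>\<sigma> p < \<sigma> q\<close>.  Rotating \<open>h\<close> away from the orthogonal vector \<open>w\<close> changes \<open>R\<close> to first order by a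
positive multiple of \<open>sym_outer h w\<close>.  Here \<open>w\<close> is supported on the two eigenspaces only and is chosen
so that the part of this matrix that preserves the eigenspaces raises an eigenvalue \<open>\<sigma> p\<close> and lowers
an eigenvalue \<open>\<sigma> q\<close> by the same amount, which has negative slope.  The part connecting different
eigenspaces has slope at most zero by \<open>slope_nonpos_sym_outer\<close>.
\<close>

lemma frame_vector_eigenvector:
  assumes hS: "conj_transpose S = S" and g: "\<forall>i\<in>{1..k}. (norm (g i))\<^sup>2 = a i"
    and min: "local_minimizer (Psi N S) (frame_operators k a) (frame_operator k g)"
    and l: "l \<in> {1..k}"
  shows "\<exists>c :: real. (S - frame_operator k g) *v g l = c *\<^sub>R g l"
proof (rule ccontr)
  assume contra: "\<not> ?thesis"
  define T where "T = frame_operator k g"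
  define R where "R = S - T"
  define h where "h = g l"
  have hR: "conj_transpose R = R"
    by (simp add: R_def T_def conj_transpose_diff hS hermitian_frame_operator)
  obtain f \<sigma> where f: "onb f" "R = spec_mat f \<sigma>"
    by (rule extend_eigenbasis[OF hR hR refl, of 0 "\<lambda>_. 0" "\<lambda>_. 0" "\<lambda>_. 0"])
       (auto simp: orthonormal_def)
  have Rf: "R *v f j = \<sigma> j *\<^sub>R f j" if "j < CARD('d)" for j
    using spec_mat_eigen[OF f(1) that, of \<sigma>] by (simp only: f(2))
  have "\<exists>p q. p < CARD('d) \<and> q < CARD('d) \<and> cinner (f p) h \<noteq> 0 \<and> cinner (f q) h \<noteq> 0 \<and> \<sigma> p < \<sigma> q"
  proof (rule ccontr)
    assume "\<not> ?thesis"
    then have all: "\<sigma> i = \<sigma> j" if "i < CARD('d)" "j < CARD('d)" "cinner (f i) h \<noteq> 0" "cinner (f j) h \<noteq> 0" for i j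
      using that by (meson linorder_neqE_linordered_idom)
    obtain c where c: "\<And>j. j < CARD('d) \<Longrightarrow> cinner (f j) h \<noteq> 0 \<Longrightarrow> \<sigma> j = c"
      using all by metis
    have "R *v h = (\<Sum>j<CARD('d). R *v (cinner (f j) h *s f j))"
      by (subst onb_expansion[OF f(1), of h]) (simp only: matrix_vector_mult_sum)
    also have "\<dots> = (\<Sum>j<CARD('d). c *\<^sub>R (cinner (f j) h *s f j))"
    proof (intro sum.cong refl)
      fix j assume "j \<in> {..<CARD('d)}"
      then show "R *v (cinner (f j) h *s f j) = c *\<^sub>R (cinner (f j) h *s f j)"
        using c[of j] Rf[of j]
        by (cases "cinner (f j) h = 0") (simp_all add: vector_scalar_commute scaleR_vec_eq mult.commute)
    qed
    also have "\<dots> = c *\<^sub>R h"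
      unfolding scaleR_sum_right[symmetric] using onb_expansion[OF f(1), of h] by simp
    finally show False using contra by (auto simp: h_def R_def T_def)
  qed
  then obtain p q where pq: "p < CARD('d)" "q < CARD('d)" "cinner (f p) h \<noteq> 0" "cinner (f q) h \<noteq> 0" "\<sigma> p < \<sigma> q"
    by blast
  define P where "P r = (\<Sum>j | j < CARD('d) \<and> \<sigma> j = r. cinner (f j) h *s f j)" for r
  have hP: "h - P r = (\<Sum>j | j < CARD('d) \<and> \<sigma> j \<noteq> r. cinner (f j) h *s f j)" for r
  proof -
    have "h = (\<Sum>j<CARD('d). cinner (f j) h *s f j)" by (rule onb_expansion[OF f(1)])
    also have "\<dots> = P r + (\<Sum>j | j < CARD('d) \<and> \<sigma> j \<noteq> r. cinner (f j) h *s f j)"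
      unfolding P_def by (subst sum.union_disjoint[symmetric]) (auto intro!: sum.cong)
    finally show ?thesis by (simp add: algebra_simps)
  qed
  have RP: "R *v P r = r *\<^sub>R P r" for r
    unfolding P_def matrix_vector_mult_sum scaleR_sum_right
    by (intro sum.cong) (auto simp: vector_scalar_commute Rf scaleR_vec_eq mult.commute)
  have orth: "cinner (P r) (h - P r) = 0" for r
    unfolding hP unfolding P_def cinner_sum_left cinner_sum_right using f(1)
    by (intro sum.neutral ballI) (auto simp: cinner_simps orthonormal_def)
  have PP: "cinner (P r) h = of_real ((norm (P r))\<^sup>2)" for r
    using orth[of r] by (simp add: cinner_diff_right cinner_self)
  have Pne: "P (\<sigma> j) \<noteq> 0" if "j < CARD('d)" "cinner (f j) h \<noteq> 0" for j
  proof -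
    have "cinner (f j) (P (\<sigma> j)) = (\<Sum>i | i < CARD('d) \<and> \<sigma> i = \<sigma> j. if i = j then cinner (f j) h else 0)"
      unfolding P_def cinner_sum_right using f(1) that
      by (intro sum.cong) (auto simp: cinner_simps orthonormal_def)
    also have "\<dots> = cinner (f j) h" using that by simp
    finally show ?thesis using that by auto
  qed
  have off: "slope_nonpos N R (sym_outer (h - P r) x)" if "R *v x = r *\<^sub>R x" for r x
    unfolding hP sym_outer_sum
  proof (rule slope_nonpos_sum)
    fix j assume "j \<in> {j. j < CARD('d) \<and> \<sigma> j \<noteq> r}"
    then show "slope_nonpos N R (sym_outer (cinner (f j) h *s f j) x)"
      by (intro slope_nonpos_sym_outer[OF hR _ that, of _ "\<sigma> j"])
         (auto simp: vector_scalar_commute Rf scaleR_vec_eq mult.commute)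
  qed
  define n where "n r = P r /\<^sub>R (norm (P r))\<^sup>2" for r
  have Rn: "R *v n r = r *\<^sub>R n r" "R *v (- n r) = r *\<^sub>R (- n r)" for r
    using RP[of r] matrix_vector_mult_scaleR[of R "-1" "n r"]
    by (simp_all add: n_def matrix_vector_mult_scaleR)
  have block: "sym_outer (P r) (n r) = 2 *\<^sub>R rank_one (P r /\<^sub>R norm (P r))" if "P r \<noteq> 0" for r
    using that by (simp add: n_def sym_outer_scaleR_right sym_outer_self rank_one_scaleR power_inverse)
  \<comment> \<open>The scaling in \<open>n\<close> gives both parts of \<open>w\<close> the same inner product with \<open>h\<close>, so \<open>w\<close> is orthogonal
    to \<open>h\<close>, and makes both block contributions unit projections up to the common factor 2.\<close>
  define w where "w = n (\<sigma> p) - n (\<sigma> q)"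
  have Pp: "P (\<sigma> p) \<noteq> 0" and Pq: "P (\<sigma> q) \<noteq> 0" using Pne pq by auto
  have nh: "cinner (n r) h = 1" if "P r \<noteq> 0" for r
    using that PP[of r] by (simp add: n_def cinner_simps)
  have wh: "cinner w h = 0"
    using nh[OF Pp] nh[OF Pq] by (simp add: w_def cinner_simps)
  have w0: "w \<noteq> 0"
  proof
    assume "w = 0"
    then have "R *v n (\<sigma> p) = R *v n (\<sigma> q)" by (simp add: w_def)
    then have "(\<sigma> p - \<sigma> q) *\<^sub>R n (\<sigma> p) = 0" using \<open>w = 0\<close> by (simp add: Rn w_def scaleR_diff_left)
    then show False using pq(5) Pp by (simp add: n_def)
  qed
  have h0: "h \<noteq> 0" using pq(3) by auto
  have D: "sym_outer h w = (2 *\<^sub>R rank_one (P (\<sigma> p) /\<^sub>R norm (P (\<sigma> p))) - 2 *\<^sub>R rank_one (P (\<sigma> q) /\<^sub>R norm (P (\<sigma> q))))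
      + (sym_outer (h - P (\<sigma> p)) (n (\<sigma> p)) + sym_outer (h - P (\<sigma> q)) (- n (\<sigma> q)))"
  proof -
    have "sym_outer h x = sym_outer (P r) x + sym_outer (h - P r) x" for r x
      by (simp add: sym_outer_add[symmetric])
    moreover have "sym_outer x (- y) = - sym_outer x y" for x y :: "complex ^ 'd"
      using sym_outer_scaleR_right[of x "-1" y] by simp
    ultimately show ?thesis
      unfolding w_def sym_outer_diff_right block[OF Pp, symmetric] block[OF Pq, symmetric]
      by (metis (no_types, lifting) add.commute add_diff_eq diff_add_eq diff_conv_add_uminus diff_diff_add)
  qed
  obtain \<eta> where \<eta>: "0 < \<eta>" "slope_le N R (2 *\<^sub>R rank_one (P (\<sigma> p) /\<^sub>R norm (P (\<sigma> p))) - 2 *\<^sub>R rank_one (P (\<sigma> q) /\<^sub>R norm (P (\<sigma> q)))) (- \<eta>)"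
    by (rule slope_average[OF hR, of "P (\<sigma> q) /\<^sub>R norm (P (\<sigma> q))" "\<sigma> q" "P (\<sigma> p) /\<^sub>R norm (P (\<sigma> p))" "\<sigma> p"])
       (use Pp Pq pq(5) in \<open>auto simp: matrix_vector_mult_scaleR RP\<close>)
  have "slope_nonpos N R (sym_outer (h - P (\<sigma> p)) (n (\<sigma> p)) + sym_outer (h - P (\<sigma> q)) (- n (\<sigma> q)))"
    by (intro slope_nonpos_add off Rn)
  then have "slope_le N R (sym_outer (h - P (\<sigma> p)) (n (\<sigma> p)) + sym_outer (h - P (\<sigma> q)) (- n (\<sigma> q))) (\<eta> / 2)"
    using \<eta>(1) by (simp add: slope_nonpos_def)
  from slope_le_add[OF \<eta>(2) this] have slope: "slope_le N R (sym_outer h w) (- (\<eta> / 2))"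
    unfolding D by (simp add: field_simps)
  \<comment> \<open>Scales \<open>w\<close> to the length of \<open>h\<close>, so that rotating \<open>h\<close> towards \<open>- \<kappa> w\<close> preserves the norm.\<close>
  define \<kappa> where "\<kappa> = norm h / norm w"
  have \<kappa>: "\<kappa> > 0" using h0 w0 by (simp add: \<kappa>_def)
  define G where "G = \<kappa>\<^sup>2 *\<^sub>R rank_one w - rank_one h"
  have curve: "\<forall>\<^sub>F t in at_right 0. \<exists>E. norm E \<le> (2 / \<kappa>\<^sup>2 * norm G) * t\<^sup>2 \<and> T - t *\<^sub>R sym_outer h w + E \<in> frame_operators k a"
  proof -
    have "\<forall>\<^sub>F t in at_right 0. (1 / \<kappa>) * t + 0 * t\<^sup>2 < 1 / 2"
      by (rule eventually_at_right_linear_less) simp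
    then show ?thesis
      using eventually_at_right_less[of 0]
    proof eventually_elim
      case (elim t)
      have "\<bar>t / \<kappa>\<bar> \<le> 1 / 2" using elim \<kappa> by simp
      then obtain c s where cs: "c\<^sup>2 + s\<^sup>2 = 1" "c * s = t / \<kappa>" "s\<^sup>2 \<le> 2 * (t / \<kappa>)\<^sup>2"
        by (rule small_rotation)
      define h' where "h' = c *\<^sub>R h + (- s * \<kappa>) *\<^sub>R w"
      have "h \<bullet> w = 0" using wh Re_cinner[of w h] by (simp add: inner_commute)
      then have "(norm h')\<^sup>2 = c\<^sup>2 * (norm h)\<^sup>2 + s\<^sup>2 * (\<kappa>\<^sup>2 * (norm w)\<^sup>2)"
        unfolding h'_def power2_norm_eq_inner
        by (simp add: inner_diff_left inner_diff_right inner_add_left inner_add_right inner_commute[of w h] power2_eq_square)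
      also have "\<kappa>\<^sup>2 * (norm w)\<^sup>2 = (norm h)\<^sup>2" using w0 by (simp add: \<kappa>_def power_divide)
      also have "c\<^sup>2 * (norm h)\<^sup>2 + s\<^sup>2 * (norm h)\<^sup>2 = (norm h)\<^sup>2"
        using cs(1) by (metis distrib_right mult_1)
      finally have nh': "(norm h')\<^sup>2 = a l" using g l by (simp add: h_def)
      have "frame_operator k (g(l := h')) = T - rank_one h + rank_one h'"
      proof -
        have "frame_operator k (g(l := h')) = rank_one h' + (\<Sum>i\<in>{1..k} - {l}. rank_one (g i))"
          unfolding frame_operator_def using l by (simp add: sum.remove[of _ l])
        moreover have "T = rank_one h + (\<Sum>i\<in>{1..k} - {l}. rank_one (g i))"
          unfolding T_def frame_operator_def h_def using l by (simp add: sum.remove[of _ l])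
        ultimately show ?thesis by simp
      qed
      also have "\<dots> = T - t *\<^sub>R sym_outer h w + s\<^sup>2 *\<^sub>R G"
      proof -
        have "c * (- s * \<kappa>) = - t" using cs(2) \<kappa> by (simp add: field_simps)
        moreover have c2: "c\<^sup>2 = 1 - s\<^sup>2" using cs(1) by simp
        ultimately show ?thesis
          unfolding h'_def rank_one_comb G_def c2 by (simp add: algebra_simps power_mult_distrib)
      qed
      finally have "T - t *\<^sub>R sym_outer h w + s\<^sup>2 *\<^sub>R G \<in> frame_operators k a"
        using g nh' unfolding frame_operators_def by (auto intro!: exI[of _ "g(l := h')"])
      moreover have "norm (s\<^sup>2 *\<^sub>R G) \<le> (2 / \<kappa>\<^sup>2 * norm G) * t\<^sup>2"
        using mult_right_mono[OF cs(3), of "norm G"] by (simp add: power_divide algebra_simps)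
      ultimately show ?case by blast
    qed
  qed
  show False
    using local_minimizer_no_descent[OF min[folded T_def] curve slope[unfolded R_def]] \<eta>(1) by simp
qed

end

section \<open>Exchange-optimal spectra are unique\<close>

text \<open>
With \<open>\<sigma>\<close> the spectrum of \<open>S\<close> and \<open>x\<close> that of \<open>T\<close>, moving \<open>\<delta>\<close> from \<open>x j\<close> to \<open>x i\<close> lowers the
eigenvalue \<open>\<sigma> i - x i\<close> of \<open>S - T\<close> and raises \<open>\<sigma> j - x j\<close>.
\<close>

definition exchange_optimal :: "nat \<Rightarrow> nat \<Rightarrow> (nat \<Rightarrow> real) \<Rightarrow> (nat \<Rightarrow> real) \<Rightarrow> (nat \<Rightarrow> real) \<Rightarrow> bool" where
  "exchange_optimal d k a \<sigma> x \<longleftrightarrow> (\<forall>i<d. \<forall>j<d. i \<noteq> j \<longrightarrow>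
     (\<exists>\<delta>\<^sub>0>0. \<forall>\<delta>. 0 < \<delta> \<longrightarrow> \<delta> < \<delta>\<^sub>0 \<longrightarrow> feasible d k a (x(i := x i + \<delta>, j := x j - \<delta>))) \<longrightarrow>
     \<sigma> i - x i \<le> \<sigma> j - x j)"

lemma prefix_sum_exchange:
  fixes x :: "nat \<Rightarrow> real"
  assumes "i \<noteq> j"
  shows "(\<Sum>l<p. (x(i := x i + b, j := x j - c)) l) =
    (\<Sum>l<p. x l) + (if i < p then b else 0) - (if j < p then c else 0)"
  using assms by (induction p) (auto simp: less_Suc_eq)

text \<open>
Let \<open>j\<close> be the first index after \<open>i\<close> with \<open>y j < x j\<close>, which exists because the totals agree.  Moving
weight in \<open>x\<close> from \<open>j\<close> forward to \<open>i\<close> only increases prefix sums.  Moving weight in \<open>y\<close> from \<open>i\<close> back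
to \<open>j\<close> lowers the prefix sums that end between \<open>i\<close> and \<open>j\<close>, but there \<open>y\<close> exceeds \<open>x\<close> by at least
\<open>y i - x i\<close>.  The two optimality conditions give
\<open>\<sigma> i - x i \<le> \<sigma> j - x j < \<sigma> j - y j \<le> \<sigma> i - y i < \<sigma> i - x i\<close>.
\<close>

lemma exchange_optimal_first_difference:
  assumes fx: "feasible d k a x" and fy: "feasible d k a y"
    and ox: "exchange_optimal d k a \<sigma> x" and oy: "exchange_optimal d k a \<sigma> y"
    and i: "i < d" "x i < y i" "\<And>l. l < i \<Longrightarrow> x l = y l"
  shows False
proof -
  have tot: "(\<Sum>l<d. x l) = (\<Sum>l<d. y l)" using fx fy by (simp add: feasible_def)
  have "\<exists>j. i < j \<and> j < d \<and> y j < x j"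
  proof (rule ccontr)
    assume "\<not> ?thesis"
    then have "x l \<le> y l" if "l < d" for l
      using that i by (metis less_le_not_le linorder_neqE_nat not_le order_refl)
    then have "(\<Sum>l<d. x l) < (\<Sum>l<d. y l)"
      using i by (intro sum_strict_mono_ex1) auto
    then show False using tot by simp
  qed
  then obtain j where j: "i < j" "j < d" "y j < x j" and least: "\<And>l. i < l \<Longrightarrow> l < j \<Longrightarrow> x l \<le> y l"
    using exists_least_iff[of "\<lambda>j. i < j \<and> j < d \<and> y j < x j"] by (metis not_le order.strict_trans)
  have y0: "0 \<le> y j" and x0: "0 \<le> x i" using fx fy i j by (auto simp: feasible_def)
  have "feasible d k a (x(i := x i + \<delta>, j := x j - \<delta>))" if \<delta>: "0 < \<delta>" "\<delta> < x j" for \<delta>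
  proof -
    have "top_sum k a p \<le> (\<Sum>l<p. (x(i := x i + \<delta>, j := x j - \<delta>)) l)" if p: "p \<le> d" for p
    proof -
      have "top_sum k a p \<le> (\<Sum>l<p. x l)" using fx p by (simp add: feasible_def)
      then show ?thesis using j \<delta> by (subst prefix_sum_exchange) auto
    qed
    moreover have "(\<Sum>l<d. (x(i := x i + \<delta>, j := x j - \<delta>)) l) = (\<Sum>i=1..k. a i)"
      using fx i j by (subst prefix_sum_exchange) (auto simp: feasible_def)
    moreover have "0 \<le> (x(i := x i + \<delta>, j := x j - \<delta>)) l" if "l < d" for l
      using fx that x0 \<delta> by (auto simp: feasible_def)
    ultimately show ?thesis unfolding feasible_def by blast
  qed
  then have "\<sigma> i - x i \<le> \<sigma> j - x j"
    using ox i j y0 unfolding exchange_optimal_def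
    by (metis less_imp_neq order.strict_trans1)
  moreover have "feasible d k a (y(j := y j + \<delta>, i := y i - \<delta>))" if \<delta>: "0 < \<delta>" "\<delta> < y i - x i" for \<delta>
  proof -
    have "top_sum k a p \<le> (\<Sum>l<p. (y(j := y j + \<delta>, i := y i - \<delta>)) l)" if p: "p \<le> d" for p
    proof (cases "i < p \<and> p \<le> j")
      case True
      have "(\<Sum>l<p. x l) + (y i - x i) \<le> (\<Sum>l<p. y l)"
      proof -
        have "(\<Sum>l\<in>{..<p} - {i}. x l) \<le> (\<Sum>l\<in>{..<p} - {i}. y l)"
        proof (rule sum_mono)
          fix l assume "l \<in> {..<p} - {i}"
          then show "x l \<le> y l"
            using True least[of l] i(3)[of l] by (cases "l < i") auto
        qed
        then show ?thesis
          using True by (simp add: sum.remove[of "{..<p}" i])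
      qed
      moreover have "top_sum k a p \<le> (\<Sum>l<p. x l)" using fx p by (simp add: feasible_def)
      ultimately show ?thesis
        using True j \<delta> by (subst prefix_sum_exchange) auto
    next
      case False
      have "top_sum k a p \<le> (\<Sum>l<p. y l)" using fy p by (simp add: feasible_def)
      then show ?thesis
        using False j \<delta> by (subst prefix_sum_exchange) auto
    qed
    moreover have "(\<Sum>l<d. (y(j := y j + \<delta>, i := y i - \<delta>)) l) = (\<Sum>i=1..k. a i)"
      using fy i j by (subst prefix_sum_exchange) (auto simp: feasible_def)
    moreover have "0 \<le> (y(j := y j + \<delta>, i := y i - \<delta>)) l" if "l < d" for l
      using fy that x0 y0 \<delta> by (auto simp: feasible_def)
    ultimately show ?thesis unfolding feasible_def by blast
  qed
  then have "\<exists>\<delta>\<^sub>0>0. \<forall>\<delta>. 0 < \<delta> \<longrightarrow> \<delta> < \<delta>\<^sub>0 \<longrightarrow> feasible d k a (y(j := y j + \<delta>, i := y i - \<delta>))"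
    using i(2) by (intro exI[of _ "y i - x i"]) auto
  then have "\<sigma> j - y j \<le> \<sigma> i - y i"
    using oy i j unfolding exchange_optimal_def by (metis less_imp_neq)
  ultimately show False using i j by linarith
qed

lemma exchange_optimal_unique:
  assumes fx: "feasible d k a x" and fy: "feasible d k a y"
    and ox: "exchange_optimal d k a \<sigma> x" and oy: "exchange_optimal d k a \<sigma> y" and j: "j < d"
  shows "x j = y j"
proof (rule ccontr)
  assume "x j \<noteq> y j"
  then obtain i where i: "i < d" "x i \<noteq> y i" "\<And>l. l < i \<Longrightarrow> x l = y l"
    using j exists_least_iff[of "\<lambda>i. i < d \<and> x i \<noteq> y i"] by (metis order.strict_trans)
  show False
  proof (cases "x i < y i")
    case True
    then show ?thesis using exchange_optimal_first_difference[OF fx fy ox oy] i by blast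
  next
    case False
    then have "y i < x i" using i(2) by simp
    then show ?thesis using exchange_optimal_first_difference[OF fy fx oy ox i(1)] i(3) by metis
  qed
qed

section \<open>Stationarity of local minimizers\<close>

text \<open>
The necessary condition that every strictly convex unitarily invariant norm imposes on its local
minimizers.  It mentions no norm, and the spectrum of \<open>S - T\<close> is determined by it.
\<close>

definition stationary :: "complex ^ 'd ^ 'd \<Rightarrow> nat \<Rightarrow> (nat \<Rightarrow> real) \<Rightarrow> complex ^ 'd ^ 'd \<Rightarrow> bool" where
  "stationary (S :: complex ^ 'd ^ 'd) k a T \<longleftrightarrow> (\<exists>u \<sigma> x. onb u \<and> S = spec_mat u \<sigma> \<and> T = spec_mat u x \<and>
     (\<forall>i j. i < j \<longrightarrow> j < CARD('d) \<longrightarrow> \<sigma> j \<le> \<sigma> i) \<and>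
     feasible CARD('d) k a x \<and> exchange_optimal CARD('d) k a \<sigma> x)"

context
  fixes N :: "complex ^ 'd ^ 'd \<Rightarrow> real"
  assumes N: "strictly_convex_ui_norm N"
begin

lemma local_minimizer_commutes:
  assumes hS: "conj_transpose S = S" and min: "local_minimizer (Psi N S) (frame_operators k a) T"
  shows "S ** T = T ** S"
proof -
  have "T \<in> frame_operators k a" using min by (simp add: local_minimizer_def)
  then obtain g where g: "T = frame_operator k g" "\<forall>i\<in>{1..k}. (norm (g i))\<^sup>2 = a i"
    by (auto simp: frame_operators_def)
  have hT: "conj_transpose T = T" by (simp add: g(1) hermitian_frame_operator)
  have hR: "conj_transpose (S - T) = S - T" by (simp add: conj_transpose_diff hS hT)
  have "(S - T) *v (rank_one (g i) *v y) = rank_one (g i) *v ((S - T) *v y)" if i: "i \<in> {1..k}" for i y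
  proof -
    obtain c :: real where c: "(S - T) *v g i = c *\<^sub>R g i"
      using frame_vector_eigenvector[OF N hS g(2) min[unfolded g(1)] i] g(1) by blast
    have "cinner (g i) ((S - T) *v y) = of_real c * cinner (g i) y"
      using cinner_hermitian[OF hR, of "g i" y] by (simp add: c cinner_simps)
    then show ?thesis
      by (simp add: rank_one_mult vector_scalar_commute c scaleR_vec_eq mult.commute)
  qed
  then have "(S - T) *v (T *v y) = T *v ((S - T) *v y)" for y
    unfolding g(1) frame_operator_def[of k g] sum_matrix_vector_mult matrix_vector_mult_sum
    by (intro sum.cong) (auto simp: frame_operator_def)
  then have "S *v (T *v y) = T *v (S *v y)" for y
    by (simp add: matrix_vector_mult_diff_rdistrib matrix_vector_mult_diff_distrib)
  then show ?thesis by (simp add: matrix_eq matrix_vector_mul_assoc[symmetric])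
qed

text \<open>
Let \<open>\<rho>0\<close> be half the difference of the eigenvalues of \<open>S - T\<close> at \<open>u i\<close> and \<open>u j\<close>.  Rotating \<open>T\<close> by a
small angle with sine \<open>s\<close> in this plane keeps the sum of these two eigenvalues and changes the square
of half their difference to \<open>\<rho>\<^sup>2 = \<rho>0\<^sup>2 + \<Delta> s\<^sup>2 (\<sigma> i - \<sigma> j)\<close> with \<open>\<Delta> = x i - x j\<close>.  If \<open>\<Delta>\<close> is negative,
the two eigenvalues come strictly closer together.
\<close>

lemma local_minimizer_aligned:
  fixes u :: "nat \<Rightarrow> complex ^ 'd"
  assumes u: "onb u" and S: "S = spec_mat u \<sigma>" and T: "T = spec_mat u x"
    and min: "local_minimizer (Psi N S) (frame_operators k a) T"
    and ij: "i < CARD('d)" "j < CARD('d)" and less: "\<sigma> j < \<sigma> i"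
  shows "x j \<le> x i"
proof (rule ccontr)
  assume "\<not> x j \<le> x i"
  define \<Delta> where "\<Delta> = x i - x j"
  have \<Delta>: "\<Delta> < 0" using \<open>\<not> x j \<le> x i\<close> by (simp add: \<Delta>_def)
  define r where "r = (\<lambda>l. \<sigma> l - x l)"
  have R: "S - T = spec_mat u r" by (simp add: S T spec_mat_diff r_def)
  define \<rho>0 where "\<rho>0 = (r i - r j) / 2"
  have \<rho>0: "2 * \<rho>0 + \<Delta> = \<sigma> i - \<sigma> j"
    by (simp add: \<rho>0_def r_def \<Delta>_def field_simps)
  have ne: "i \<noteq> j" using less by auto
  obtain \<epsilon> where \<epsilon>: "0 < \<epsilon>" "\<And>T'. T' \<in> frame_operators k a \<Longrightarrow> norm (T' - T) < \<epsilon> \<Longrightarrow> N (S - T) \<le> N (S - T')"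
    by (rule local_minimizer_near[OF N min]) blast
  define F where "F = sym_outer (u i) (u j)"
  define G where "G = rank_one (u i) - rank_one (u j)"
  have "\<forall>\<^sub>F t in at_right (0 :: real). 0 < t \<and> 1 * t + 0 * t\<^sup>2 < 1 / 2 \<and> (\<bar>\<Delta>\<bar> * norm F) * t + (\<bar>\<Delta>\<bar> * 2 * norm G) * t\<^sup>2 < \<epsilon>"
    by (intro eventually_conj eventually_at_right_less eventually_at_right_linear_less \<epsilon>(1)) simp
  then obtain t where t: "0 < t" "t < 1 / 2" "(\<bar>\<Delta>\<bar> * norm F) * t + (\<bar>\<Delta>\<bar> * 2 * norm G) * t\<^sup>2 < \<epsilon>"
    using eventually_happens'[OF trivial_limit_at_right_real[of 0]] by auto
  then have "\<bar>t\<bar> \<le> 1 / 2" by simp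
  then obtain c s where cs: "c\<^sup>2 + s\<^sup>2 = 1" "c * s = t" "s\<^sup>2 \<le> 2 * t\<^sup>2"
    by (rule small_rotation)
  have s0: "s\<^sup>2 > 0" using cs(2) t(1) by auto
  define T' where "T' = spec_mat (rotate2 u i j c s) x"
  have T': "T' = T + \<Delta> *\<^sub>R (t *\<^sub>R F - s\<^sup>2 *\<^sub>R G)"
    unfolding T'_def spec_mat_rotate2[OF ij ne cs(1)] by (simp add: T \<Delta>_def F_def G_def cs(2))
  have "T \<in> frame_operators k a" using min by (simp add: local_minimizer_def)
  then have "T' \<in> frame_operators k a"
    unfolding T'_def using frame_operators_change_basis[OF u onb_rotate2[OF u ij ne cs(1)]] T by blast
  moreover have "norm (T' - T) < \<epsilon>"
  proof -
    have "norm (T' - T) \<le> \<bar>\<Delta>\<bar> * (norm (t *\<^sub>R F) + norm (s\<^sup>2 *\<^sub>R G))"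
      using mult_left_mono[OF norm_triangle_ineq4[of "t *\<^sub>R F" "s\<^sup>2 *\<^sub>R G"], of "\<bar>\<Delta>\<bar>"]
      unfolding T' by simp
    also have "\<dots> \<le> \<bar>\<Delta>\<bar> * (t * norm F + 2 * t\<^sup>2 * norm G)"
      using t(1) cs(3) by (intro mult_left_mono add_mono) (auto intro: mult_right_mono)
    also have "\<dots> < \<epsilon>" using t(3) by (simp add: algebra_simps)
    finally show ?thesis .
  qed
  ultimately have le: "N (S - T) \<le> N (S - T')" by (rule \<epsilon>(2))
  obtain \<rho> c' s' where cs': "c'\<^sup>2 + s'\<^sup>2 = 1" "\<rho> * (1 - 2 * s'\<^sup>2) = \<rho>0 + \<Delta> * s\<^sup>2" "2 * \<rho> * (c' * s') = - \<Delta> * t"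
    "\<rho>\<^sup>2 = (\<rho>0 + \<Delta> * s\<^sup>2)\<^sup>2 + (- \<Delta> * t)\<^sup>2"
    by (rule half_angle)
  have "s\<^sup>2 * s\<^sup>2 + t\<^sup>2 = s\<^sup>2"
  proof -
    have "s\<^sup>2 * s\<^sup>2 + t\<^sup>2 = s\<^sup>2 * (c\<^sup>2 + s\<^sup>2)"
      unfolding cs(2)[symmetric] by (simp add: power_mult_distrib algebra_simps)
    then show ?thesis by (simp add: cs(1))
  qed
  moreover have "\<rho>\<^sup>2 = \<rho>0\<^sup>2 + 2 * \<rho>0 * \<Delta> * s\<^sup>2 + \<Delta>\<^sup>2 * (s\<^sup>2 * s\<^sup>2 + t\<^sup>2)"
    unfolding cs'(4) by (simp add: power2_eq_square algebra_simps)
  ultimately have "\<rho>\<^sup>2 = \<rho>0\<^sup>2 + \<Delta> * s\<^sup>2 * (2 * \<rho>0 + \<Delta>)"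
    by (simp add: power2_eq_square algebra_simps)
  moreover have "\<Delta> * s\<^sup>2 * (2 * \<rho>0 + \<Delta>) < 0"
    unfolding \<rho>0 using \<Delta> s0 less by (intro mult_neg_pos) auto
  ultimately have "\<rho>\<^sup>2 < \<rho>0\<^sup>2" by linarith
  moreover have "0 < \<rho>0" using \<rho>0 \<Delta> less by linarith
  ultimately have "\<bar>\<rho>\<bar> < \<rho>0" using power2_less_imp_less[of "\<bar>\<rho>\<bar>" \<rho>0] by simp
  \<comment> \<open>The spectrum of \<open>S - T'\<close>: the mean of the two eigenvalues is kept and half their difference becomes
    \<open>\<rho>\<close>, which may be negative.\<close>
  define r' where "r' = r(i := r i - (\<rho>0 - \<rho>), j := r j + (\<rho>0 - \<rho>))"
  have "S - T' = spec_mat (rotate2 u i j c' s') r'"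
  proof -
    have "r' i - r' j = 2 * \<rho>" using ne by (simp add: r'_def \<rho>0_def)
    then have "spec_mat (rotate2 u i j c' s') r' = spec_mat u r' + (2 * \<rho>) *\<^sub>R ((c' * s') *\<^sub>R F - s'\<^sup>2 *\<^sub>R G)"
      unfolding spec_mat_rotate2[OF ij ne cs'(1)] by (simp add: F_def G_def)
    also have "spec_mat u r' = spec_mat u r + (\<rho> - \<rho>0) *\<^sub>R G"
      using ij ne by (simp add: r'_def spec_mat_update G_def algebra_simps)
    also have "\<dots> + (2 * \<rho>) *\<^sub>R ((c' * s') *\<^sub>R F - s'\<^sup>2 *\<^sub>R G) =
        spec_mat u r + (2 * \<rho> * (c' * s')) *\<^sub>R F + (\<rho> * (1 - 2 * s'\<^sup>2) - \<rho>0) *\<^sub>R G"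
      by (simp add: algebra_simps)
    also have "\<dots> = S - T'"
      unfolding cs'(2,3) T' R[symmetric] by (simp add: algebra_simps)
    finally show ?thesis ..
  qed
  then have "N (S - T') = N (spec_mat u r')"
    using ui_norm_spec_mat_basis[OF N onb_rotate2[OF u ij ne cs'(1)] u] by simp
  also have "\<dots> < N (spec_mat u r)"
  proof -
    have "2 * \<rho>0 = r i - r j" by (simp add: \<rho>0_def)
    then have "r j < r i" "0 < \<rho>0 - \<rho>" "\<rho>0 - \<rho> < r i - r j" using \<open>\<bar>\<rho>\<bar> < \<rho>0\<close> by linarith+
    then show ?thesis unfolding r'_def by (rule ui_norm_average_less[OF N u ij])
  qed
  finally show False using le R by simp
qed

text \<open>
An exchange inside the polytope is a path of frame operators by \<open>feasible_imp_frame_operator\<close>, and it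
averages two eigenvalues of \<open>S - T\<close>.
\<close>

lemma local_minimizer_exchange_optimal:
  fixes u :: "nat \<Rightarrow> complex ^ 'd"
  assumes u: "onb u" and S: "S = spec_mat u \<sigma>" and T: "T = spec_mat u x" and pos: "\<forall>i\<in>{1..k}. 0 < a i"
    and min: "local_minimizer (Psi N S) (frame_operators k a) T"
  shows "exchange_optimal CARD('d) k a \<sigma> x"
  unfolding exchange_optimal_def
proof (intro allI impI)
  fix i j assume ij: "i < CARD('d)" "j < CARD('d)" "i \<noteq> j"
  assume "\<exists>\<delta>\<^sub>0>0. \<forall>\<delta>. 0 < \<delta> \<longrightarrow> \<delta> < \<delta>\<^sub>0 \<longrightarrow> feasible CARD('d) k a (x(i := x i + \<delta>, j := x j - \<delta>))"
  then obtain \<delta>0 where \<delta>0: "\<delta>0 > 0" "\<And>\<delta>. 0 < \<delta> \<Longrightarrow> \<delta> < \<delta>0 \<Longrightarrow> feasible CARD('d) k a (x(i := x i + \<delta>, j := x j - \<delta>))"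
    by blast
  define r where "r = (\<lambda>l. \<sigma> l - x l)"
  have R: "S - T = spec_mat u r" by (simp add: S T spec_mat_diff r_def)
  show "\<sigma> i - x i \<le> \<sigma> j - x j"
  proof (rule ccontr)
    assume "\<not> \<sigma> i - x i \<le> \<sigma> j - x j"
    then have less: "r j < r i" by (simp add: r_def)
    obtain \<epsilon> where \<epsilon>: "0 < \<epsilon>" "\<And>T'. T' \<in> frame_operators k a \<Longrightarrow> norm (T' - T) < \<epsilon> \<Longrightarrow> N (S - T) \<le> N (S - T')"
      by (rule local_minimizer_near[OF N min]) blast
    define G where "G = rank_one (u i) - rank_one (u j)"
    define m where "m = min (min \<delta>0 (r i - r j)) (\<epsilon> / (norm G + 1))"
    define \<delta> where "\<delta> = m / 2"
    have "0 < m" "m \<le> \<delta>0" "m \<le> r i - r j" "m \<le> \<epsilon> / (norm G + 1)"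
      using \<delta>0(1) less \<epsilon>(1) by (simp_all add: m_def add_nonneg_pos)
    then have \<delta>: "0 < \<delta>" "\<delta> < \<delta>0" "\<delta> < r i - r j" "\<delta> < \<epsilon> / (norm G + 1)"
      unfolding \<delta>_def by linarith+
    define x' where "x' = x(i := x i + \<delta>, j := x j - \<delta>)"
    have T': "spec_mat u x' = T + \<delta> *\<^sub>R G"
      using ij by (simp add: x'_def T spec_mat_update G_def algebra_simps)
    have "\<delta> * (norm G + 1) < \<epsilon>" using \<delta>(4) by (simp add: pos_less_divide_eq add_nonneg_pos)
    then have "norm (spec_mat u x' - T) < \<epsilon>"
      using \<delta>(1) unfolding T' by (simp add: algebra_simps)
    moreover have "spec_mat u x' \<in> frame_operators k a"
      unfolding x'_def by (rule feasible_imp_frame_operator[OF u pos \<delta>0(2)[OF \<delta>(1,2)]])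
    ultimately have "N (S - T) \<le> N (S - spec_mat u x')" by (intro \<epsilon>(2))
    also have "S - spec_mat u x' = spec_mat u (r(i := r i - \<delta>, j := r j + \<delta>))"
      unfolding S spec_mat_diff by (rule arg_cong[of _ _ "spec_mat u"]) (auto simp: x'_def r_def)
    also have "N \<dots> < N (spec_mat u r)"
      by (rule ui_norm_average_less[OF N u ij(1,2) less \<delta>(1,3)])
    finally show False using R by simp
  qed
qed

text \<open>
Alignment orders \<open>x\<close> where \<open>\<sigma>\<close> strictly decreases, and the lexicographic choice of the basis orders it
on ties of \<open>\<sigma>\<close>.  Only with \<open>x\<close> decreasing does \<open>frame_operator_imp_feasible\<close> apply.
\<close>

lemma local_minimizer_stationary:
  assumes hS: "conj_transpose S = S" and pos: "\<forall>i\<in>{1..k}. 0 < a i"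
    and min: "local_minimizer (Psi N S) (frame_operators k a) T"
  shows "stationary S k a T"
proof -
  have TX: "T \<in> frame_operators k a" using min by (simp add: local_minimizer_def)
  then have hT: "conj_transpose T = T" by (auto simp: frame_operators_def hermitian_frame_operator)
  obtain u \<sigma> x where u: "onb u" "S = spec_mat u \<sigma>" "T = spec_mat u x"
    and dec: "\<And>i j. i < j \<Longrightarrow> j < CARD('d) \<Longrightarrow> \<sigma> j \<le> \<sigma> i"
    and tie: "\<And>i j. i < j \<Longrightarrow> j < CARD('d) \<Longrightarrow> \<sigma> i = \<sigma> j \<Longrightarrow> x j \<le> x i"
    by (rule extend_eigenbasis[OF hS hT local_minimizer_commutes[OF hS min], of 0 "\<lambda>_. 0" "\<lambda>_. 0" "\<lambda>_. 0"])
       (auto simp: orthonormal_def)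
  have "x j \<le> x i" if "i < j" "j < CARD('d)" for i j
    using dec[OF that] tie[OF that] local_minimizer_aligned[OF u min, of i j] that by force
  then have "feasible CARD('d) k a x"
    using frame_operator_imp_feasible[OF u(1)] TX u(3) by blast
  then show ?thesis
    unfolding stationary_def using u dec local_minimizer_exchange_optimal[OF u pos min] by blast
qed

text \<open>
\<open>S\<close> may have repeated eigenvalues, so two stationary operators need not share an eigenbasis with \<open>S\<close>.
They do share the sorted spectrum \<open>\<sigma>\<close>, and therefore \<open>T\<close> and \<open>T'\<close> have the same spectrum by
\<open>exchange_optimal_unique\<close>.
\<close>

lemma stationary_same_norm:
  assumes "stationary S k a T" "stationary S k a T'"
  shows "N (S - T) = N (S - T')"
proof -
  obtain u \<sigma> x where u: "onb u" "S = spec_mat u \<sigma>" "T = spec_mat u x"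
    "\<And>i j. i < j \<Longrightarrow> j < CARD('d) \<Longrightarrow> \<sigma> j \<le> \<sigma> i" and x: "feasible CARD('d) k a x" "exchange_optimal CARD('d) k a \<sigma> x"
    using assms(1) unfolding stationary_def by blast
  obtain v \<sigma>' y where v: "onb v" "S = spec_mat v \<sigma>'" "T' = spec_mat v y"
    "\<And>i j. i < j \<Longrightarrow> j < CARD('d) \<Longrightarrow> \<sigma>' j \<le> \<sigma>' i" and y: "feasible CARD('d) k a y" "exchange_optimal CARD('d) k a \<sigma>' y"
    using assms(2) unfolding stationary_def by blast
  have \<sigma>: "\<sigma> j = \<sigma>' j" if "j < CARD('d)" for j
    by (rule sorted_spectrum_unique[OF u(1) v(1)]) (use u(2,4) v(2,4) that in auto)
  have "exchange_optimal CARD('d) k a \<sigma> y"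
    using y(2) \<sigma> unfolding exchange_optimal_def by auto
  then have "x j = y j" if "j < CARD('d)" for j
    using exchange_optimal_unique[OF x(1) y(1) x(2) _ that] by blast
  then have "S - T' = spec_mat v (\<lambda>j. \<sigma> j - x j)"
    unfolding v(2,3) spec_mat_diff using \<sigma> by (intro spec_mat_cong) simp
  then show ?thesis
    using ui_norm_spec_mat_basis[OF N u(1) v(1)] by (simp add: u(2,3) spec_mat_diff)
qed

end

section \<open>Local minimizers are global for all norms at once\<close>

text \<open>
With \<open>N = N'\<close> this is the first half of the theorem; with different norms it makes the minimizers of \<open>N\<close>
minimizers of \<open>N'\<close>.
\<close>

lemma local_minimizer_imp_global:
  assumes N: "strictly_convex_ui_norm N" and N': "strictly_convex_ui_norm N'"
    and hS: "conj_transpose S = S" and pos: "\<forall>i\<in>{1..k}. 0 < a i"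
    and min: "local_minimizer (Psi N S) (frame_operators k a) T" and T': "T' \<in> frame_operators k a"
  shows "Psi N' S T \<le> Psi N' S T'"
proof -
  let ?X = "frame_operators k a"
  have "continuous_on ?X (\<lambda>T. N' (S - T))"
    by (intro continuous_on_compose2[OF ui_norm_continuous[OF N', of UNIV]] continuous_intros) auto
  then obtain M where M: "M \<in> ?X" "\<And>T. T \<in> ?X \<Longrightarrow> N' (S - M) \<le> N' (S - T)"
    using continuous_attains_inf[OF compact_frame_operators] T' by (metis empty_iff)
  then have "local_minimizer (Psi N' S) ?X M"
    unfolding local_minimizer_def Psi_def by (intro conjI exI[of _ UNIV]) auto
  then have "N' (S - T) = N' (S - M)"
    using local_minimizer_stationary[OF N hS pos min] local_minimizer_stationary[OF N' hS pos]
      stationary_same_norm[OF N'] by blast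
  then show ?thesis using M(2)[OF T'] by (simp add: Psi_def)
qed

theorem mainTheorem3:
  fixes S :: "complex ^ 'd ^ 'd" and k :: nat and a :: "nat \<Rightarrow> real"
  assumes "psd_matrix S"
    and "\<forall>i\<in>{1..k}. 0 < a i"
  shows "(\<forall>N. strictly_convex_ui_norm N \<longrightarrow>
            (\<forall>S\<^sub>0. local_minimizer (Psi N S) (frame_operators k a) S\<^sub>0 \<longrightarrow>
                  is_arg_min (Psi N S) (\<lambda>T. T \<in> frame_operators k a) S\<^sub>0)) \<and>
         (\<forall>N N'. strictly_convex_ui_norm N \<longrightarrow> strictly_convex_ui_norm N' \<longrightarrow>
            {S\<^sub>0. local_minimizer (Psi N S) (frame_operators k a) S\<^sub>0} =
            {S\<^sub>0. local_minimizer (Psi N' S) (frame_operators k a) S\<^sub>0})"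
proof -
  have hS: "conj_transpose S = S" using assms(1) by (simp add: psd_matrix_def)
  have transfer: "local_minimizer (Psi N' S) (frame_operators k a) T"
    if "strictly_convex_ui_norm N" "strictly_convex_ui_norm N'"
      "local_minimizer (Psi N S) (frame_operators k a) T" for N N' T
  proof -
    have "T \<in> frame_operators k a" using that(3) by (simp add: local_minimizer_def)
    then show ?thesis
      using local_minimizer_imp_global[OF that(1,2) hS assms(2) that(3)]
      unfolding local_minimizer_def by (intro conjI exI[of _ UNIV]) auto
  qed
  show ?thesis
  proof (intro conjI allI impI)
    fix N S\<^sub>0 assume "strictly_convex_ui_norm N" "local_minimizer (Psi N S) (frame_operators k a) S\<^sub>0"
    then show "is_arg_min (Psi N S) (\<lambda>T. T \<in> frame_operators k a) S\<^sub>0"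
      using local_minimizer_imp_global[OF _ _ hS assms(2)]
      unfolding is_arg_min_def local_minimizer_def by (meson leD)
  next
    fix N N' :: "complex ^ 'd ^ 'd \<Rightarrow> real"
    assume "strictly_convex_ui_norm N" "strictly_convex_ui_norm N'"
    then show "{S\<^sub>0. local_minimizer (Psi N S) (frame_operators k a) S\<^sub>0} =
        {S\<^sub>0. local_minimizer (Psi N' S) (frame_operators k a) S\<^sub>0}"
      using transfer by blast
  qed
qed

end
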